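(* Let $k\ge2$, $d=k(k+1)/2$, and $r=r_k$. For $n\in\{0,\dots,d-1\}$ let $M_n=[\mu^n_{ji}]_{j,i=0}^2$ be the $3\times3$ matrix with entries $$\mu^n_{j0}=\tfrac1r\big((p^j_{n0})^2-p^j_{n0}p^j_{n1}-p^j_{n0}p^j_{n2}+p^j_{n1}p^j_{n2}\big),$$ $$\mu^n_{j1}=\tfrac1r\big((p^j_{n1})^2-p^j_{n0}p^j_{n1}+p^j_{n0}p^j_{n2}-p^j_{n1}p^j_{n2}\big),$$ $$\mu^n_{j2}=\tfrac1r\big((p^j_{n2})^2+p^j_{n0}p^j_{n1}-p^j_{n0}p^j_{n2}-p^j_{n1}p^j_{n2}\big).$$ Then for every $n$ and every cell $C=F_wK$ of $SG_k$, $$\begin{pmatrix}\nu_0(F_nC)\\\nu_1(F_nC)\\\nu_2(F_nC)\end{pmatrix}=M_n\begin{pmatrix}\nu_0(C)\\\nu_1(C)\\\nu_2(C)\end{pmatrix}.$$ Consequently, as vectors of measures, $$\begin{pmatrix}\nu_0\\\nu_1\\\nu_2\end{pmatrix}=\sum_{n=0}^{d-1}M_n\begin{pmatrix}\nu_0\circ F_n^{-1}\\\nu_1\circ F_n^{-1}\\\nu_2\circ F_n^{-1}\end{pmatrix},$$ where $(\nu_i\circ F_n^{-1})(A)=\nu_i(F_n^{-1}(A))$ for Borel $A\subseteq K$.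
   Context: Let $q_0,q_1,q_2$ be the vertices of a unit equilateral triangle $T\subset\mathbb R^2$. Fix $k\ge2$ and $d=k(k+1)/2$. Let $F_n(x)=x/k+b_n$, $n=0,\dots,d-1$, be the similitudes mapping $T$ onto the $d$ triangles of side $1/k$ with the same orientation as $T$ in the subdivision of $T$ into $k^2$ triangles. $SG_k$ is $K=\bigcup_nF_n(K)$. Notation: $F_w=F_{w_1}\circ\cdots\circ F_{w_m}$, and a cell is a set $F_wK$. $V_0=\{q_0,q_1,q_2\}$ and $V_m=\bigcup_{|w|=m}F_w(V_0)$. The graph $\Gamma_m$ on $V_m$ has $x\sim_my$ iff $x\ne y$ and $x,y\in F_w(V_0)$ for some $|w|=m$. Energy: $\mathcal E_m(u)=r^{-m}\sum_{x\sim_my}(u(x)-u(y))^2$, where $r=r_k$ is the unique $r>0$ with $\min\{\mathcal E_1(\tilde u):\tilde u|_{V_0}=u\}=\mathcal E_0(u)$ for all $u$ on $V_0$. Then $\mathcal E(u)=\lim_m\mathcal E_m(u|_{V_m})$ for continuous $u$ on $K$. A function $h$ is harmonic if $\mathcal E_m(h|_{V_m})=\mathcal E_0(h|_{V_0})$ for all $m$. $h_i$ ($i=0,1,2$) is the harmonic function with $h_i(q_j)=\delta_{ij}$. Energy measures: $\nu_u$ is the unique Borel measure with $\nu_u(F_wK)=r^{-|w|}\mathcal E(u\circ F_w)$, and $\nu_i:=\nu_{h_i}$. Probabilities: $p^j_{ni}$ is the probability that the simple random walk on $\Gamma_1$ started at $F_n(q_i)$ hits $q_j$ before hitting either of the other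 two points of $V_0$ (equivalently $p^j_{ni}=h_j(F_n(q_i))$). *)

theory Defs
  imports "HOL-Analysis.Analysis" "HOL-Library.FuncSet"
begin

definition q :: "nat \<Rightarrow> complex" where
  "q i = (if i = 0 then 0 else if i = 1 then 1 else Complex (1/2) (sqrt 3 / 2))"

definition V0 :: "complex set" where
  "V0 = {q 0, q 1, q 2}"

definition sg_d :: "nat \<Rightarrow> nat" where
  "sg_d k = k * (k + 1) div 2"

text \<open>Enumeration of the d upward triangles of side 1/k: the triangle with lower-left
  corner (a + c q2)/k, for a + c \<le> k - 1.\<close>
definition sg_cells :: "nat \<Rightarrow> (nat \<times> nat) list" where
  "sg_cells k = concat (map (\<lambda>c. map (\<lambda>a. (a, c)) [0..<k - c]) [0..<k])"

definition sg_b :: "nat \<Rightarrow> nat \<Rightarrow> complex" where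
  "sg_b k n = (let (a, c) = sg_cells k ! n in (of_nat a + of_nat c * q 2) / of_nat k)"

definition F :: "nat \<Rightarrow> nat \<Rightarrow> complex \<Rightarrow> complex" where
  "F k n x = x / of_nat k + sg_b k n"

fun Fw :: "nat \<Rightarrow> nat list \<Rightarrow> complex \<Rightarrow> complex" where
  "Fw k [] = id"
| "Fw k (n # w) = F k n \<circ> Fw k w"

definition words :: "nat \<Rightarrow> nat \<Rightarrow> nat list set" where
  "words k m = {w. length w = m \<and> set w \<subseteq> {..<sg_d k}}"

definition SG :: "nat \<Rightarrow> complex set" where
  "SG k = (THE K. compact K \<and> K \<noteq> {} \<and> K = (\<Union>n<sg_d k. F k n ` K))"

definition Vm :: "nat \<Rightarrow> nat \<Rightarrow> complex set" where
  "Vm k m = (\<Union>w\<in>words k m. Fw k w ` V0)"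

definition adj :: "nat \<Rightarrow> nat \<Rightarrow> complex \<Rightarrow> complex \<Rightarrow> bool" where
  "adj k m x y \<longleftrightarrow> x \<noteq> y \<and> (\<exists>w\<in>words k m. x \<in> Fw k w ` V0 \<and> y \<in> Fw k w ` V0)"

text \<open>Graph energy E_m(u) = r^{-m} \<Sum>_{x ~_m y} (u x - u y)^2, the sum running over the
  (unordered) edges of \<Gamma>_m, i.e. half the sum over ordered adjacent pairs.\<close>
definition Em :: "nat \<Rightarrow> real \<Rightarrow> nat \<Rightarrow> (complex \<Rightarrow> real) \<Rightarrow> real" where
  "Em k r m u = r powi (- int m) *
     ((1/2) * (\<Sum>(x, y)\<in>{(x, y). x \<in> Vm k m \<and> y \<in> Vm k m \<and> adj k m x y}. (u x - u y)^2))"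

definition rk :: "nat \<Rightarrow> real" where
  "rk k = (THE r. r > 0 \<and>
     (\<forall>u. (\<exists>v. (\<forall>x\<in>V0. v x = u x) \<and> Em k r 1 v = Em k r 0 u) \<and>
          (\<forall>v. (\<forall>x\<in>V0. v x = u x) \<longrightarrow> Em k r 0 u \<le> Em k r 1 v)))"

definition energy :: "nat \<Rightarrow> (complex \<Rightarrow> real) \<Rightarrow> real" where
  "energy k u = lim (\<lambda>m. Em k (rk k) m u)"

definition harmonic_sg :: "nat \<Rightarrow> (complex \<Rightarrow> real) \<Rightarrow> bool" where
  "harmonic_sg k h \<longleftrightarrow> (\<forall>m. Em k (rk k) m h = Em k (rk k) 0 h)"

definition hb :: "nat \<Rightarrow> nat \<Rightarrow> complex \<Rightarrow> real" where
  "hb k i = (THE h. h \<in> extensional (SG k) \<and> continuous_on (SG k) h \<and> harmonic_sg k h \<and>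
                    (\<forall>j<3. h (q j) = (if i = j then 1 else 0)))"

definition energy_measure :: "nat \<Rightarrow> (complex \<Rightarrow> real) \<Rightarrow> complex measure" where
  "energy_measure k u = (THE \<nu>. sets \<nu> = sets (restrict_space borel (SG k)) \<and>
     (\<forall>m. \<forall>w\<in>words k m. emeasure \<nu> (Fw k w ` SG k) =
          ennreal (rk k powi (- int m) * energy k (u \<circ> Fw k w))))"

definition nu :: "nat \<Rightarrow> nat \<Rightarrow> complex measure" where
  "nu k i = energy_measure k (hb k i)"

text \<open>p^j_{ni} = h_j(F_n(q_i)) (the hitting probability of the random walk on \<Gamma>_1).\<close>
definition p :: "nat \<Rightarrow> nat \<Rightarrow> nat \<Rightarrow> nat \<Rightarrow> real" where
  "p k j n i = hb k j (F k n (q i))"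

definition mu :: "nat \<Rightarrow> nat \<Rightarrow> nat \<Rightarrow> nat \<Rightarrow> real" where
  "mu k n j i =
    (let a = p k j n 0; b = p k j n 1; c = p k j n 2 in
     (if i = 0 then (a^2 - a*b - a*c + b*c)
      else if i = 1 then (b^2 - a*b + a*c - b*c)
      else (c^2 + a*b - a*c - b*c)) / rk k)"

end

theory Submission
  imports Defs
begin

text \<open>
  A function on the gasket that is harmonic is determined by its three boundary values, and on a
  cell its boundary values are a linear image of those; with \<open>h\<^sub>0 + h\<^sub>1 + h\<^sub>2 = 1\<close> the polarised
  energies of the \<open>h\<^sub>i\<close> on a cell are combinations of the energies themselves, which gives
  the matrices. All objects are defined by description, so the work lies in existence and
  uniqueness. The scaling factor exists because the trace of the level-1 form is invariant under
  two reflections, hence a multiple of the triangle energy. A flux argument shows that a cell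
  carries at most a fixed proportion \<open>theta < 1\<close> of the energy of its parent; this makes
  piecewise linear approximations converge uniformly to the harmonic functions and makes the
  energy measures atomless, so that overlaps of cells (single points) have measure zero. The
  measure identity follows from the cell identity on closed sets, which are decreasing limits of
  unions of cells.
\<close>

subsection \<open>Lattice coordinates\<close>

text \<open>Two obstacles shape the measure part. Cells overlap and are not stable under
  intersection, so their values do not determine a measure by the usual uniqueness theorem. For a
  given measure with the prescribed cell values, subadditivity together with the total mass gives
  the mass of every union of cells of one level; for existence the overlaps have to be proved null
  beforehand. Secondly, the matrix entries may be negative: for \<open>k = 2\<close>, in the cell at
  \<open>q 0\<close>, \<open>h_1\<close> takes the values 0, 2/5, 1/5, so that
  \<open>mu k n 1 2\<close> is negative. The right-hand side of the measure identity is therefore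
  not visibly a measure, and the comparison is made between real-valued countably additive set
  functions. The entries come from polarisation. Since \<open>h_0 + h_1 = 1 - h_2\<close> and
  constants have no energy, \<open>2 E(h_0, h_1) = E(h_2) - E(h_0) - E(h_1)\<close>, and cyclically;
  inserting this into \<open>E(a h_0 + b h_1 + c h_2)\<close> gives the three coefficients. In
  \<open>theta = 1 - renorm / 2\<close> the 2 is the Cauchy-Schwarz loss for the two edges leaving a
  vertex.\<close>

definition cx :: "complex \<Rightarrow> real" where
  "cx z = Re z - Im z / sqrt 3"

definition cy :: "complex \<Rightarrow> real" where
  "cy z = 2 * Im z / sqrt 3"

text \<open>The inverse of the coordinates \<open>cx\<close>, \<open>cy\<close>, which refer to the
  real basis 1, \<open>q 2\<close>. There the triangle becomes the standard simplex and level-m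
  cells become its integer translates scaled by \<open>k^m\<close>, so incidence questions are
  linear arithmetic without \<open>sqrt 3\<close>.\<close>

definition pt :: "real \<Rightarrow> real \<Rightarrow> complex" where
  "pt x y = of_real x + of_real y * q 2"

lemma q_numeral: "q 0 = 0" "q (Suc 0) = 1" "q 2 = Complex (1/2) (sqrt 3 / 2)"
  by (simp_all add: q_def)

lemma lattice_eqI: "cx z = cx z' \<Longrightarrow> cy z = cy z' \<Longrightarrow> z = z'"
  by (auto simp: cx_def cy_def complex_eq_iff)

lemma cx_simps [simp]:
  "cx (y + z) = cx y + cx z" "cx (y - z) = cx y - cx z" "cx (z / of_nat n) = cx z / real n"
  "cx (q 0) = 0" "cx (q (Suc 0)) = 1" "cx (q 2) = 0"
  by (simp_all add: cx_def q_def add_divide_distrib diff_divide_distrib)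

lemma cy_simps [simp]:
  "cy (y + z) = cy y + cy z" "cy (y - z) = cy y - cy z" "cy (z / of_nat n) = cy z / real n"
  "cy (q 0) = 0" "cy (q (Suc 0)) = 0" "cy (q 2) = 1"
  by (simp_all add: cy_def q_def add_divide_distrib diff_divide_distrib distrib_left right_diff_distrib)

lemma cx_pt [simp]: "cx (pt x y) = x" and cy_pt [simp]: "cy (pt x y) = y"
  by (simp_all add: cx_def cy_def pt_def q_def)

lemma pt_coords [simp]: "pt (cx z) (cy z) = z"
  by (rule lattice_eqI) simp_all

lemma continuous_on_cx [continuous_intros]: "continuous_on A cx"
  unfolding cx_def by (intro continuous_intros) auto

lemma continuous_on_cy [continuous_intros]: "continuous_on A cy"
  unfolding cy_def by (intro continuous_intros) auto

lemma less_3: "i < (3::nat) \<longleftrightarrow> i = 0 \<or> i = Suc 0 \<or> i = 2"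
  by auto

lemma sum_less_3: "(\<Sum>i<3. f i) = f 0 + f (Suc 0) + f (2::nat)"
  by (simp add: numeral_3_eq_3 numeral_2_eq_2)

lemma V0_eq: "V0 = q ` {..<3}"
  by (auto simp: V0_def less_3)

lemma q_in_V0 [simp]: "i < 3 \<Longrightarrow> q i \<in> V0"
  by (simp add: V0_eq)

lemma q_inj: "i < 3 \<Longrightarrow> j < 3 \<Longrightarrow> q i = q j \<longleftrightarrow> i = j"
  by (auto simp: less_3 q_def complex_eq_iff)

section \<open>The triangle and its integer translates\<close>

definition closed_tri :: "complex set" where
  "closed_tri = {z. 0 \<le> cx z \<and> 0 \<le> cy z \<and> cx z + cy z \<le> 1}"

lemma triangle_norm_le: "z \<in> closed_tri \<Longrightarrow> norm z \<le> 2"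
proof -
  assume z: "z \<in> closed_tri"
  have "norm (q 2) = 1"
    by (simp add: q_numeral cmod_def power2_eq_square)
  then have "norm (pt (cx z) (cy z)) \<le> \<bar>cx z\<bar> + \<bar>cy z\<bar>"
    unfolding pt_def by (metis norm_triangle_ineq norm_of_real norm_mult mult.right_neutral)
  then show ?thesis using z by (simp add: closed_tri_def)
qed

lemma compact_triangle: "compact closed_tri"
proof -
  have "closed closed_tri"
    unfolding closed_tri_def
    by (intro closed_Collect_conj closed_Collect_le continuous_intros)
  moreover have "bounded closed_tri"
    using triangle_norm_le by (auto simp: bounded_iff)
  ultimately show ?thesis by (simp add: compact_eq_bounded_closed)
qed

lemma V0_subset_triangle: "V0 \<subseteq> closed_tri"
  by (auto simp: V0_def closed_tri_def)

lemma V0_lattice: "z \<in> V0 \<longleftrightarrow> (cx z = 0 \<and> cy z = 0) \<or> (cx z = 1 \<and> cy z = 0) \<or> (cx z = 0 \<and> cy z = 1)"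
  unfolding V0_def by (auto intro: lattice_eqI)

lemma nat_diff_unit_interval:
  fixes s t :: real and a b :: nat
  assumes "s + real a = t + real b" "0 \<le> s" "s \<le> 1" "0 \<le> t" "t \<le> 1"
  shows "a = b \<and> s = t \<or> a = Suc b \<and> s = 0 \<and> t = 1 \<or> b = Suc a \<and> s = 1 \<and> t = 0"
proof -
  have "real a \<le> real b + 1" "real b \<le> real a + 1" using assms by linarith+
  then have "a = b \<or> a = Suc b \<or> b = Suc a" by linarith
  then show ?thesis using assms by auto
qed

text \<open>Where the integer offsets differ, they differ by 1, and the coordinate is 0 in one
  simplex and 1 in the other. A coordinate equal to 1 forces the other one to be 0, and this leaves
  only vertices.\<close>

lemma triangle_translates_meet:
  fixes a b c e :: nat
  assumes z: "z \<in> closed_tri" and z': "z' \<in> closed_tri"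
    and eq: "cx z + real a = cx z' + real b" "cy z + real c = cy z' + real e"
    and ne: "a \<noteq> b \<or> c \<noteq> e"
  shows "z \<in> V0" and "z' \<in> V0"
proof -
  have zz: "0 \<le> cx z" "0 \<le> cy z" "cx z + cy z \<le> 1" "0 \<le> cx z'" "0 \<le> cy z'" "cx z' + cy z' \<le> 1"
    using z z' by (auto simp: closed_tri_def)
  have 1: "a = b \<and> cx z = cx z' \<or> a = Suc b \<and> cx z = 0 \<and> cx z' = 1 \<or> b = Suc a \<and> cx z = 1 \<and> cx z' = 0"
    by (rule nat_diff_unit_interval) (use eq zz in auto)
  have 2: "c = e \<and> cy z = cy z' \<or> c = Suc e \<and> cy z = 0 \<and> cy z' = 1 \<or> e = Suc c \<and> cy z = 1 \<and> cy z' = 0"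
    by (rule nat_diff_unit_interval) (use eq zz in auto)
  show "z \<in> V0" "z' \<in> V0"
    using 1 2 zz ne unfolding V0_lattice by linarith+
qed

text \<open>This is what prevents two cells from sharing an edge: they have at most one point in
  common.\<close>

lemma triangle_translates_meet_unique:
  fixes a b c e :: nat
  assumes z: "z1 \<in> closed_tri" "z1' \<in> closed_tri" "z2 \<in> closed_tri" "z2' \<in> closed_tri"
    and eq: "cx z1 + real a = cx z1' + real b" "cy z1 + real c = cy z1' + real e"
      "cx z2 + real a = cx z2' + real b" "cy z2 + real c = cy z2' + real e"
    and ne: "a \<noteq> b \<or> c \<noteq> e"
  shows "z1 = z2"
proof (rule lattice_eqI)
  have zz: "0 \<le> cx z1" "0 \<le> cy z1" "cx z1 + cy z1 \<le> 1" "0 \<le> cx z1'" "0 \<le> cy z1'" "cx z1' + cy z1' \<le> 1"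
     "0 \<le> cx z2" "0 \<le> cy z2" "cx z2 + cy z2 \<le> 1" "0 \<le> cx z2'" "0 \<le> cy z2'" "cx z2' + cy z2' \<le> 1"
    using z by (auto simp: closed_tri_def)
  have "a = b \<and> cx z1 = cx z1' \<or> a = Suc b \<and> cx z1 = 0 \<and> cx z1' = 1 \<or> b = Suc a \<and> cx z1 = 1 \<and> cx z1' = 0"
    "c = e \<and> cy z1 = cy z1' \<or> c = Suc e \<and> cy z1 = 0 \<and> cy z1' = 1 \<or> e = Suc c \<and> cy z1 = 1 \<and> cy z1' = 0"
    "a = b \<and> cx z2 = cx z2' \<or> a = Suc b \<and> cx z2 = 0 \<and> cx z2' = 1 \<or> b = Suc a \<and> cx z2 = 1 \<and> cx z2' = 0"
    "c = e \<and> cy z2 = cy z2' \<or> c = Suc e \<and> cy z2 = 0 \<and> cy z2' = 1 \<or> e = Suc c \<and> cy z2 = 1 \<and> cy z2' = 0"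
    by (rule nat_diff_unit_interval; use eq zz in linarith)+
  then show "cx z1 = cx z2" "cy z1 = cy z2"
    using zz ne by linarith+
qed

subsection \<open>Cells and words\<close>

definition cell_col :: "nat \<Rightarrow> nat \<Rightarrow> nat" where "cell_col k n = fst (sg_cells k ! n)"
definition cell_row :: "nat \<Rightarrow> nat \<Rightarrow> nat" where "cell_row k n = snd (sg_cells k ! n)"

definition cells :: "nat \<Rightarrow> (nat \<times> nat) set" where
  "cells k = {(a, c). a + c < k}"

lemma set_sg_cells: "set (sg_cells k) = cells k"
  by (force simp: sg_cells_def cells_def)

lemma distinct_concat_sections:
  "distinct cs \<Longrightarrow> distinct (concat (map (\<lambda>c. map (\<lambda>a. (a, c)) [0..<g c]) cs))"
  by (induction cs) (auto simp: distinct_map inj_on_def)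

lemma distinct_sg_cells: "distinct (sg_cells k)"
  unfolding sg_cells_def by (rule distinct_concat_sections) simp

lemma length_sg_cells: "length (sg_cells k) = sg_d k"
proof -
  have "length (sg_cells k) = (\<Sum>c<k. k - c)"
    by (simp add: sg_cells_def length_concat comp_def interv_sum_list_conv_sum_set_nat atLeast0LessThan)
  also have "\<dots> = (\<Sum>c<k. Suc c)"
    by (subst sum.nat_diff_reindex [symmetric]) (simp add: Suc_diff_Suc)
  also have "\<dots> = sg_d k"
    unfolding sg_d_def by (induction k) auto
  finally show ?thesis .
qed

lemma bij_betw_cells: "bij_betw (\<lambda>n. (cell_col k n, cell_row k n)) {..<sg_d k} (cells k)"
  using bij_betw_nth[OF distinct_sg_cells[of k] length_sg_cells[symmetric, THEN arg_cong[of _ _ lessThan]] set_sg_cells[symmetric]]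
  by (simp add: cell_col_def cell_row_def length_sg_cells)

lemma cell_bound: "n < sg_d k \<Longrightarrow> cell_col k n + cell_row k n < k"
  using bij_betw_cells[of k] by (force simp: bij_betw_def cells_def)

lemma cell_inj: "n < sg_d k \<Longrightarrow> n' < sg_d k \<Longrightarrow> cell_col k n = cell_col k n' \<Longrightarrow> cell_row k n = cell_row k n' \<Longrightarrow> n = n'"
  using bij_betw_cells[of k] by (auto simp: bij_betw_def inj_on_def)

lemma cell_ex: "a + c < k \<Longrightarrow> \<exists>n<sg_d k. cell_col k n = a \<and> cell_row k n = c"
proof -
  assume "a + c < k"
  then have "(a, c) \<in> (\<lambda>n. (cell_col k n, cell_row k n)) ` {..<sg_d k}"
    using bij_betw_cells[of k] by (simp add: bij_betw_def cells_def)
  then show ?thesis by auto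
qed

lemma sg_b_pt: "sg_b k n = pt (real (cell_col k n)) (real (cell_row k n)) / of_nat k"
  by (simp add: sg_b_def cell_col_def cell_row_def pt_def split_beta Let_def)

lemma cx_F [simp]: "cx (F k n z) = (cx z + real (cell_col k n)) / real k"
  and cy_F [simp]: "cy (F k n z) = (cy z + real (cell_row k n)) / real k"
  by (simp_all add: F_def sg_b_pt add_divide_distrib)

lemma finite_words [simp]: "finite (words k m)"
proof -
  have "words k m = {w. set w \<subseteq> {..<sg_d k} \<and> length w = m}"
    by (auto simp: words_def)
  then show ?thesis by (simp add: finite_lists_length_eq)
qed

lemma words_0 [simp]: "words k 0 = {[]}"
  by (auto simp: words_def)

lemma words_Suc_Cons: "words k (Suc m) = (\<lambda>(n, w). n # w) ` ({..<sg_d k} \<times> words k m)"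
  by (auto simp: words_def image_iff length_Suc_conv)

lemma words_Suc_snoc: "words k (Suc m) = (\<lambda>(w, n). w @ [n]) ` (words k m \<times> {..<sg_d k})"
  by (auto simp: words_def image_iff length_Suc_conv_rev)

lemma Cons_in_words: "n # w \<in> words k (Suc m) \<longleftrightarrow> n < sg_d k \<and> w \<in> words k m"
  by (auto simp: words_def)

lemma snoc_in_words: "w @ [n] \<in> words k (Suc m) \<longleftrightarrow> n < sg_d k \<and> w \<in> words k m"
  by (auto simp: words_def)

lemma sum_words_Cons: "(\<Sum>w\<in>words k (Suc m). g w) = (\<Sum>n<sg_d k. \<Sum>w\<in>words k m. g (n # w))"
  unfolding words_Suc_Cons
  by (subst sum.reindex) (auto simp: inj_on_def sum.cartesian_product split_beta)

lemma sum_words_snoc: "(\<Sum>w\<in>words k (Suc m). g w) = (\<Sum>w\<in>words k m. \<Sum>n<sg_d k. g (w @ [n]))"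
  unfolding words_Suc_snoc
  by (subst sum.reindex) (auto simp: inj_on_def sum.cartesian_product split_beta)

lemma Fw_append: "Fw k (v @ w) = Fw k v \<circ> Fw k w"
  by (induction v) (auto simp: comp_assoc)

lemma Fw_snoc: "Fw k (w @ [n]) z = Fw k w (F k n z)"
  by (simp add: Fw_append)

text \<open>A base-\<open>k\<close> numeral with the first letter as leading digit. With digits
  \<open>cell_col\<close> or \<open>cell_row\<close> it is a lattice coordinate of the cell's
  corner, scaled by \<open>k ^ length w\<close>.\<close>

fun word_coord :: "nat \<Rightarrow> (nat \<Rightarrow> nat) \<Rightarrow> nat list \<Rightarrow> nat" where
  "word_coord k g [] = 0"
| "word_coord k g (n # w) = word_coord k g w + g n * k ^ length w"

definition tri_energy :: "(complex \<Rightarrow> real) \<Rightarrow> real" where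
  "tri_energy u = (u (q 0) - u (q 1))\<^sup>2 + (u (q 0) - u (q 2))\<^sup>2 + (u (q 1) - u (q 2))\<^sup>2"

locale sierpinski =
  fixes k :: nat
  assumes k_ge2: "2 \<le> k"
begin

abbreviation d :: nat where "d \<equiv> sg_d k"

lemma k_pos: "0 < k" "0 < real k" using k_ge2 by auto

lemma cx_Fw: "cx (Fw k w z) = (cx z + real (word_coord k (cell_col k) w)) / real k ^ length w"
  using k_pos by (induction w) (simp_all add: field_simps)

lemma cy_Fw: "cy (Fw k w z) = (cy z + real (word_coord k (cell_row k) w)) / real k ^ length w"
  using k_pos by (induction w) (simp_all add: field_simps)

lemma word_coord_less:
  assumes "\<And>n. n < d \<Longrightarrow> g n < k" "w \<in> words k m"
  shows "word_coord k g w < k ^ m"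
  using assms(2)
proof (induction w arbitrary: m)
  case (Cons n w)
  then obtain m' where m: "m = Suc m'" "w \<in> words k m'" "n < d" and l: "length w = m'"
    by (cases m) (auto simp: Cons_in_words words_def)
  have "g n + 1 \<le> k" using assms(1) m by (simp add: Suc_leI)
  then have "(g n + 1) * k ^ m' \<le> k * k ^ m'" by (rule mult_right_mono) simp
  with Cons.IH[OF m(2)] show ?case using m l by (simp add: algebra_simps)
qed (auto simp: words_def)

lemma cell_col_less: "n < d \<Longrightarrow> cell_col k n < k" and cell_row_less: "n < d \<Longrightarrow> cell_row k n < k"
  using cell_bound[of n k] by auto

text \<open>Uniqueness of base-\<open>k\<close> digits: reduction modulo \<open>k ^ m\<close>
  recovers the tail, hence also the leading digit, and column and row together determine the
  letter.\<close>

lemma word_eqI: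
  assumes "w \<in> words k m" "w' \<in> words k m"
    and "word_coord k (cell_col k) w = word_coord k (cell_col k) w'" "word_coord k (cell_row k) w = word_coord k (cell_row k) w'"
  shows "w = w'"
  using assms
proof (induction m arbitrary: w w')
  case (Suc m)
  obtain n v n' v' where w: "w = n # v" "w' = n' # v'" "n < d" "n' < d" "v \<in> words k m" "v' \<in> words k m"
    using Suc.prems(1,2) unfolding words_Suc_Cons by auto
  have len: "length v = m" "length v' = m" using w by (auto simp: words_def)
  have dm: "g n = g n' \<and> word_coord k g v = word_coord k g v'"
    if "word_coord k g w = word_coord k g w'" "\<And>n. n < d \<Longrightarrow> g n < k" for g
  proof -
    have lt: "word_coord k g v < k ^ m" "word_coord k g v' < k ^ m" using word_coord_less that(2) w by auto
    have eq: "word_coord k g v + g n * k ^ m = word_coord k g v' + g n' * k ^ m" using that(1) w len by simp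
    have "word_coord k g v = word_coord k g v'" using arg_cong[OF eq, of "\<lambda>x. x mod k ^ m"] lt by simp
    then show ?thesis using eq k_pos by simp
  qed
  have "cell_col k n = cell_col k n'" "cell_row k n = cell_row k n'" "v = v'"
    using dm[of "cell_col k"] dm[of "cell_row k"] cell_col_less cell_row_less Suc.prems(3,4) Suc.IH w by blast+
  then show ?case using w cell_inj by blast
qed auto

lemma words_meet:
  assumes "w \<in> words k m" "w' \<in> words k m" "w \<noteq> w'" "z \<in> closed_tri" "z' \<in> closed_tri"
    and "Fw k w z = Fw k w' z'"
  shows "z \<in> V0" "z' \<in> V0"
proof -
  have len: "length w = m" "length w' = m" using assms by (auto simp: words_def)
  have "cx z + real (word_coord k (cell_col k) w) = cx z' + real (word_coord k (cell_col k) w')"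
       "cy z + real (word_coord k (cell_row k) w) = cy z' + real (word_coord k (cell_row k) w')"
    using arg_cong[OF assms(6), of cx] arg_cong[OF assms(6), of cy] k_pos len
    by (simp_all add: cx_Fw cy_Fw)
  then show "z \<in> V0" "z' \<in> V0"
    using triangle_translates_meet[of z z'] word_eqI assms by metis+
qed

lemma words_meet_unique:
  assumes "w \<in> words k m" "w' \<in> words k m" "w \<noteq> w'"
    and "z1 \<in> closed_tri" "z1' \<in> closed_tri" "Fw k w z1 = Fw k w' z1'"
    and "z2 \<in> closed_tri" "z2' \<in> closed_tri" "Fw k w z2 = Fw k w' z2'"
  shows "z1 = z2"
proof -
  have len: "length w = m" "length w' = m" using assms by (auto simp: words_def)
  have "cx z1 + real (word_coord k (cell_col k) w) = cx z1' + real (word_coord k (cell_col k) w')"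
       "cy z1 + real (word_coord k (cell_row k) w) = cy z1' + real (word_coord k (cell_row k) w')"
       "cx z2 + real (word_coord k (cell_col k) w) = cx z2' + real (word_coord k (cell_col k) w')"
       "cy z2 + real (word_coord k (cell_row k) w) = cy z2' + real (word_coord k (cell_row k) w')"
    using arg_cong[OF assms(6), of cx] arg_cong[OF assms(6), of cy] 
      arg_cong[OF assms(9), of cx] arg_cong[OF assms(9), of cy] k_pos len
    by (simp_all add: cx_Fw cy_Fw)
  then show ?thesis
    using triangle_translates_meet_unique word_eqI assms by metis
qed

lemma single_word: "n < d \<Longrightarrow> [n] \<in> words k 1"
  by (simp add: words_def)

lemma cells_meet:
  assumes "n < d" "n' < d" "n \<noteq> n'" "z \<in> closed_tri" "z' \<in> closed_tri" "F k n z = F k n' z'"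
  shows "z \<in> V0" "z' \<in> V0"
  using words_meet[OF single_word[of n] single_word[of n'], of z z'] assms by auto

lemma F_inj: "F k n z = F k n z' \<longleftrightarrow> z = z'"
  using k_pos by (auto simp: F_def)

lemma Fw_inj: "Fw k w z = Fw k w z' \<longleftrightarrow> z = z'"
  by (induction w) (auto simp: F_inj)

lemma F_triangle: "n < d \<Longrightarrow> z \<in> closed_tri \<Longrightarrow> F k n z \<in> closed_tri"
  using cell_bound[of n k] k_pos
  by (auto simp: closed_tri_def simp flip: add_divide_distrib of_nat_add)

lemma dist_Fw: "w \<in> words k m \<Longrightarrow> dist (Fw k w x) (Fw k w y) = dist x y / real k ^ m"
proof (induction w arbitrary: m)
  case (Cons n w)
  then obtain m' where m: "m = Suc m'" "w \<in> words k m'"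
    by (cases m) (auto simp: Cons_in_words words_def)
  have "dist (F k n a) (F k n b) = dist a b / real k" for a b
    by (simp add: F_def dist_norm norm_divide flip: diff_divide_distrib)
  then show ?case using Cons.IH[OF m(2)] m by simp
qed (auto simp: words_def)

lemma continuous_on_F [continuous_intros]: "continuous_on A (F k n)"
  unfolding F_def using k_pos by (intro continuous_intros) auto

lemma continuous_on_Fw [continuous_intros]: "continuous_on A (Fw k w)"
proof (induction w)
  case (Cons n w)
  from continuous_on_compose[OF Cons continuous_on_F] show ?case by simp
qed (simp add: id_def)

lemma F_linear_coords: "F k n z = pt ((cx z + real (cell_col k n)) / real k) ((cy z + real (cell_row k n)) / real k)"
  by (rule lattice_eqI) simp_all

text \<open>Two distinct cells of one level share at most one point, so every edge of the graph
  belongs to exactly one cell and the energy splits over cells. Each cell contributes its three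
  edges in both orientations, which cancels the factor 1/2.\<close>

lemma Em_eq: "Em k r m u = r powi (- int m) * (\<Sum>w\<in>words k m. tri_energy (u \<circ> Fw k w))"
proof -
  define I where "I = {(i, j). i < (3::nat) \<and> j < (3::nat) \<and> i \<noteq> j}"
  have I: "I = {(0, 1), (0, 2), (1, 0), (1, 2), (2, 0), (2, 1)}"
    by (auto simp: I_def less_3)
  define E where "E w = (\<lambda>(i, j). (Fw k w (q i), Fw k w (q j))) ` I" for w
  have "{(x, y). x \<in> Vm k m \<and> y \<in> Vm k m \<and> adj k m x y} = (\<Union>w\<in>words k m. E w)"
    unfolding Vm_def adj_def E_def I_def V0_eq by (auto simp: image_iff Fw_inj q_inj split_beta) blast+
  moreover have "(\<Sum>(x, y)\<in>(\<Union>w\<in>words k m. E w). (u x - u y)\<^sup>2)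
      = (\<Sum>w\<in>words k m. \<Sum>(x, y)\<in>E w. (u x - u y)\<^sup>2)"
  proof (rule sum.UNION_disjoint)
    show "\<forall>w\<in>words k m. finite (E w)" by (simp add: E_def I)
    show "\<forall>w\<in>words k m. \<forall>w'\<in>words k m. w \<noteq> w' \<longrightarrow> E w \<inter> E w' = {}"
    proof (intro ballI impI, rule ccontr)
      fix w w' assume w: "w \<in> words k m" "w' \<in> words k m" "w \<noteq> w'" "E w \<inter> E w' \<noteq> {}"
      then obtain i j i' j' where ij: "i < 3" "j < 3" "i \<noteq> j" "i' < 3" "j' < 3"
        "Fw k w (q i) = Fw k w' (q i')" "Fw k w (q j) = Fw k w' (q j')"
        by (auto simp: E_def I_def)
      then have "q i = q j"
        using words_meet_unique[OF w(1-3)] V0_subset_triangle q_in_V0 by (metis subsetD)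
      with ij q_inj show False by blast
    qed
  qed simp
  moreover have "(\<Sum>(x, y)\<in>E w. (u x - u y)\<^sup>2) = 2 * tri_energy (u \<circ> Fw k w)" for w
  proof -
    have "inj_on (\<lambda>(i, j). (Fw k w (q i), Fw k w (q j))) I"
      by (auto simp: inj_on_def I_def Fw_inj q_inj)
    then have "(\<Sum>(x, y)\<in>E w. (u x - u y)\<^sup>2) = (\<Sum>(i, j)\<in>I. (u (Fw k w (q i)) - u (Fw k w (q j)))\<^sup>2)"
      unfolding E_def by (subst sum.reindex) (auto intro: sum.cong)
    then show ?thesis by (simp add: I tri_energy_def power2_commute)
  qed
  ultimately show ?thesis
    unfolding Em_def by (simp flip: sum_distrib_left)
qed

end

subsection \<open>The level-1 energy form\<close>

definition tri_form :: "(complex \<Rightarrow> real) \<Rightarrow> (complex \<Rightarrow> real) \<Rightarrow> real" where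
  "tri_form u v = (u (q 0) - u (q 1)) * (v (q 0) - v (q 1)) + (u (q 0) - u (q 2)) * (v (q 0) - v (q 2))
     + (u (q 1) - u (q 2)) * (v (q 1) - v (q 2))"

definition vec_energy :: "(nat \<Rightarrow> real) \<Rightarrow> real" where
  "vec_energy u = (u 0 - u 1)\<^sup>2 + (u 0 - u 2)\<^sup>2 + (u 1 - u 2)\<^sup>2"

lemma tri_energy_eq_vec_energy: "tri_energy u = vec_energy (\<lambda>i. u (q i))"
  by (simp add: tri_energy_def vec_energy_def)

lemma tri_energy_nonneg [simp]: "0 \<le> tri_energy u" and vec_energy_nonneg [simp]: "0 \<le> vec_energy f"
  by (simp_all add: tri_energy_def vec_energy_def)

lemma vec_energy_cong: "(\<And>i. i < 3 \<Longrightarrow> u i = v i) \<Longrightarrow> vec_energy u = vec_energy v"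
  by (simp add: vec_energy_def)

lemma tri_energy_cong: "(\<And>i. i < 3 \<Longrightarrow> u (q i) = v (q i)) \<Longrightarrow> tri_energy u = tri_energy v"
  by (simp add: tri_energy_eq_vec_energy vec_energy_def)

lemma tri_form_self: "tri_form u u = tri_energy u"
  by (simp add: tri_form_def tri_energy_def power2_eq_square)

lemma tri_form_commute: "tri_form u v = tri_form v u"
  by (simp add: tri_form_def algebra_simps)

text \<open>The reflection fixing \<open>q 0\<close>. Together with \<open>swap01\<close> it
  generates all permutations of the three vertices, so an invariant form on boundary values has
  equal off-diagonal entries.\<close>

definition swap12 :: "complex \<Rightarrow> complex" where
  "swap12 z = pt (cy z) (cx z)"

definition swap01 :: "complex \<Rightarrow> complex" where
  "swap01 z = pt (1 - cx z - cy z) (cy z)"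

lemma swap12_q [simp]: "swap12 (q 0) = q 0" "swap12 (q (Suc 0)) = q 2" "swap12 (q 2) = q (Suc 0)"
  by (rule lattice_eqI; simp add: swap12_def)+

lemma swap01_q [simp]: "swap01 (q 0) = q (Suc 0)" "swap01 (q (Suc 0)) = q 0" "swap01 (q 2) = q 2"
  by (rule lattice_eqI; simp add: swap01_def)+

lemma swap_swap [simp]: "swap12 (swap12 z) = z" "swap01 (swap01 z) = z"
  by (rule lattice_eqI; simp add: swap12_def swap01_def)+

lemma sum_cells: "(\<Sum>n<sg_d k. g (cell_col k n) (cell_row k n)) = (\<Sum>(a, c)\<in>cells k. g a c)"
  using sum.reindex_bij_betw[OF bij_betw_cells, of "\<lambda>(a, c). g a c" k] by simp

context sierpinski
begin

definition energy1 :: "(complex \<Rightarrow> real) \<Rightarrow> real" where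
  "energy1 v = (\<Sum>n<d. tri_energy (v \<circ> F k n))"

definition form1 :: "(complex \<Rightarrow> real) \<Rightarrow> (complex \<Rightarrow> real) \<Rightarrow> real" where
  "form1 u v = (\<Sum>n<d. tri_form (u \<circ> F k n) (v \<circ> F k n))"

lemma form1_self: "form1 u u = energy1 u"
  by (simp add: form1_def energy1_def tri_form_self)

lemma form1_commute: "form1 u v = form1 v u"
  by (simp add: form1_def tri_form_commute)

lemma energy1_nonneg [simp]: "0 \<le> energy1 u"
  by (simp add: energy1_def sum_nonneg)

lemma form1_add_right: "form1 u (\<lambda>x. v x + w x) = form1 u v + form1 u w"
  by (simp add: form1_def tri_form_def sum.distrib [symmetric] algebra_simps)

lemma form1_diff_right: "form1 u (\<lambda>x. v x - w x) = form1 u v - form1 u w"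
  by (simp add: form1_def tri_form_def sum_subtractf [symmetric] algebra_simps)

lemma form1_mult_right: "form1 u (\<lambda>x. c * v x) = c * form1 u v"
  by (simp add: form1_def tri_form_def sum_distrib_left algebra_simps)

lemma form1_const_right [simp]: "form1 u (\<lambda>x. c) = 0"
  by (simp add: form1_def tri_form_def)

lemma form1_linear_left:
  "form1 (\<lambda>x. v x + w x) u = form1 v u + form1 w u"
  "form1 (\<lambda>x. v x - w x) u = form1 v u - form1 w u"
  "form1 (\<lambda>x. c * v x) u = c * form1 v u"
  using form1_add_right form1_diff_right form1_mult_right by (simp_all add: form1_commute[of _ u])

lemmas form1_linear = form1_add_right form1_diff_right form1_mult_right form1_linear_left

lemma Em_0: "Em k r 0 u = tri_energy u"
  by (simp add: Em_eq)

lemma Em_1: "Em k r (Suc 0) u = energy1 u / r"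
  using sum_words_Cons[of "\<lambda>w. tri_energy (u \<circ> Fw k w)" k 0]
  by (simp add: Em_eq energy1_def power_int_minus divide_inverse mult.commute)

section \<open>Corner cells and connectedness of the first graph\<close>

lemma corner_coords:
  assumes "i < 3" "n < d" "z \<in> closed_tri" "F k n z = q i"
  shows "z = q i \<and> cell_col k n = (if i = 1 then k - 1 else 0) \<and> cell_row k n = (if i = 2 then k - 1 else 0)"
proof -
  have x: "cx z + real (cell_col k n) = cx (q i) * real k" and y: "cy z + real (cell_row k n) = cy (q i) * real k"
    using arg_cong[OF assms(4), of cx] arg_cong[OF assms(4), of cy] k_pos by (simp_all add: field_simps)
  have z: "0 \<le> cx z" "0 \<le> cy z" "cx z + cy z \<le> 1" using assms(3) by (auto simp: closed_tri_def)
  have b: "cell_col k n + cell_row k n < k" using cell_bound assms by auto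
  then have b': "real (cell_col k n) + real (cell_row k n) + 1 \<le> real k" by linarith
  consider "i = 0" | "i = 1" | "i = 2" using assms(1) by linarith
  then show ?thesis
  proof cases
    case 1
    then have "cx z = 0" "cy z = 0" "real (cell_col k n) = 0" "real (cell_row k n) = 0" using x y z by auto
    then show ?thesis using 1 by (auto intro: lattice_eqI)
  next
    case 2
    then have "cx z = 1" "cy z = 0" "real (cell_col k n) = real k - 1" "real (cell_row k n) = 0"
      using x y z b' by auto
    then show ?thesis using 2 b by (auto intro!: lattice_eqI)
  next
    case 3
    then have "cx z = 0" "cy z = 1" "real (cell_col k n) = 0" "real (cell_row k n) = real k - 1"
      using x y z b' by auto
    then show ?thesis using 3 b by (auto intro!: lattice_eqI)
  qed
qed

lemma corner_ex: "i < 3 \<Longrightarrow> \<exists>n<d. F k n (q i) = q i"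
proof -
  assume i: "i < 3"
  have "\<exists>n<d. cell_col k n = (if i = 1 then k - 1 else 0) \<and> cell_row k n = (if i = 2 then k - 1 else 0)"
    using k_pos by (intro cell_ex) auto
  then obtain n where "n < d" "cell_col k n = (if i = 1 then k - 1 else 0)" "cell_row k n = (if i = 2 then k - 1 else 0)"
    by blast
  then have "n < d \<and> F k n (q i) = q i"
    using i k_pos by (auto simp: less_3 of_nat_diff intro!: lattice_eqI)
  then show ?thesis ..
qed

definition corner :: "nat \<Rightarrow> nat" where
  "corner i = (SOME n. n < d \<and> F k n (q i) = q i)"

lemma corner: "i < 3 \<Longrightarrow> corner i < d" "i < 3 \<Longrightarrow> F k (corner i) (q i) = q i"
  using someI_ex[OF corner_ex] unfolding corner_def by blast+

lemma q_in_closed_tri [simp]: "i < 3 \<Longrightarrow> q i \<in> closed_tri"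
  using V0_subset_triangle q_in_V0 by blast

text \<open>A vertex of the triangle lies in only one level-1 cell. This later confines the flux at
  that vertex to a single cell.\<close>

lemma corner_unique:
  assumes "i < 3" "n < d" "z \<in> closed_tri" "F k n z = q i"
  shows "z = q i" "n = corner i"
  using corner_coords[OF assms] corner_coords[OF assms(1) corner(1) q_in_closed_tri corner(2)] assms
    cell_inj corner(1) by auto

lemma corner_inj: "i < 3 \<Longrightarrow> j < 3 \<Longrightarrow> corner i = corner j \<Longrightarrow> i = j"
  using corner_coords[OF _ corner(1) q_in_closed_tri corner(2), of i]
    corner_coords[OF _ corner(1) q_in_closed_tri corner(2), of j] k_ge2
  by (auto simp: less_3)

text \<open>Connectedness of the level-1 graph. The upward cell at \<open>(a, c)\<close> joins that
  lattice point to its right and upper neighbours, so every vertex is reached from the origin along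
  the bottom row and then upwards.\<close>

lemma energy1_zero_imp_const:
  assumes "energy1 v = 0" "n < d" "i < 3"
  shows "v (F k n (q i)) = v (q 0)"
proof -
  define g where "g a c = v (pt (real a / real k) (real c / real k))" for a c :: nat
  have step: "g (Suc a) c = g a c \<and> g a (Suc c) = g a c" if ac: "a + c < k" for a c
  proof -
    obtain n where n: "n < d" "cell_col k n = a" "cell_row k n = c" using cell_ex ac by blast
    have "\<forall>n\<in>{..<d}. tri_energy (v \<circ> F k n) = 0"
      using assms(1) unfolding energy1_def by (subst (asm) sum_nonneg_eq_0_iff) auto
    then have "tri_energy (v \<circ> F k n) = 0" using n by simp
    then have "v (F k n (q 0)) = v (F k n (q 1))" "v (F k n (q 0)) = v (F k n (q 2))"
      by (simp_all add: tri_energy_def add_nonneg_eq_0_iff)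
    then show ?thesis unfolding g_def F_linear_coords n by (simp add: add.commute)
  qed
  have "g a 0 = g 0 0" if "a \<le> k" for a
    using that by (induction a) (auto simp: step)
  moreover have "g a c = g a 0" if "a + c \<le> k" for a c
    using that by (induction c) (auto simp: step)
  ultimately have all: "g a c = g 0 0" if "a + c \<le> k" for a c
    using that by (metis add_leD1)
  have b: "cell_col k n + cell_row k n < k" using cell_bound assms(2) by auto
  have "\<exists>a c. a + c \<le> k \<and> F k n (q i) = pt (real a / real k) (real c / real k)"
    using assms(3) unfolding less_3
  proof (elim disjE)
    assume "i = 0" then show ?thesis using b
      by (intro exI[of _ "cell_col k n"] exI[of _ "cell_row k n"]) (simp add: F_linear_coords)
  next
    assume "i = Suc 0" then show ?thesis using b
      by (intro exI[of _ "Suc (cell_col k n)"] exI[of _ "cell_row k n"]) (simp add: F_linear_coords)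
  next
    assume "i = 2" then show ?thesis using b
      by (intro exI[of _ "cell_col k n"] exI[of _ "Suc (cell_row k n)"]) (simp add: F_linear_coords)
  qed
  then obtain a c where "a + c \<le> k" "F k n (q i) = pt (real a / real k) (real c / real k)" by blast
  moreover have "g 0 0 = v (q 0)"
    by (simp add: g_def pt_def q_def)
  ultimately show ?thesis using all unfolding g_def by metis
qed

section \<open>Invariance of the level-1 form under reflections\<close>

lemma form1_swap12: "form1 (u \<circ> swap12) (v \<circ> swap12) = form1 u v"
proof -
  define T where "T a c z = pt ((cx z + real a) / real k) ((cy z + real c) / real k)" for a c z
  have FT: "F k n = T (cell_col k n) (cell_row k n)" for n by (rule ext) (simp add: F_linear_coords T_def)
  have sw: "swap12 (T a c z) = T c a (swap12 z)" for a c z by (simp add: T_def swap12_def)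
  have b: "tri_form (u \<circ> swap12 \<circ> T a c) (v \<circ> swap12 \<circ> T a c) = tri_form (u \<circ> T c a) (v \<circ> T c a)" for a c
    by (simp add: tri_form_def sw algebra_simps)
  show ?thesis
    unfolding form1_def FT b sum_cells[of "\<lambda>a c. tri_form (u \<circ> T c a) (v \<circ> T c a)"]
      sum_cells[of "\<lambda>a c. tri_form (u \<circ> T a c) (v \<circ> T a c)"]
    by (rule sum.reindex_bij_witness[of _ prod.swap prod.swap]) (auto simp: cells_def)
qed

lemma form1_swap01: "form1 (u \<circ> swap01) (v \<circ> swap01) = form1 u v"
proof -
  define T where "T a c z = pt ((cx z + real a) / real k) ((cy z + real c) / real k)" for a c z
  have FT: "F k n = T (cell_col k n) (cell_row k n)" for n by (rule ext) (simp add: F_linear_coords T_def)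
  \<comment> \<open>The reflection exchanging \<open>q 0\<close> and \<open>q 1\<close> reverses
    each row; row \<open>c\<close> has its corners at \<open>a = 0, ..., k - 1 - c\<close>.\<close>
  have sw: "swap01 (T a c z) = T (k - 1 - a - c) c (swap01 z)" if "(a, c) \<in> cells k" for a c z
  proof -
    have "real (k - 1 - a - c) = real k - 1 - real a - real c"
      using that by (simp add: cells_def of_nat_diff)
    then show ?thesis
      using k_pos unfolding T_def swap01_def by (intro lattice_eqI) (simp_all add: diff_divide_distrib add_divide_distrib)
  qed
  have b: "tri_form (u \<circ> swap01 \<circ> T a c) (v \<circ> swap01 \<circ> T a c)
      = tri_form (u \<circ> T (k - 1 - a - c) c) (v \<circ> T (k - 1 - a - c) c)" if "(a, c) \<in> cells k" for a c
    by (simp add: tri_form_def sw[OF that] algebra_simps)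
  have "form1 (u \<circ> swap01) (v \<circ> swap01)
      = (\<Sum>(a, c)\<in>cells k. tri_form (u \<circ> T (k - 1 - a - c) c) (v \<circ> T (k - 1 - a - c) c))"
    unfolding form1_def FT sum_cells[of "\<lambda>a c. tri_form (u \<circ> swap01 \<circ> T a c) (v \<circ> swap01 \<circ> T a c)"]
    by (rule sum.cong) (auto simp: b)
  also have "\<dots> = (\<Sum>(a, c)\<in>cells k. tri_form (u \<circ> T a c) (v \<circ> T a c))"
    by (rule sum.reindex_bij_witness[of _ "\<lambda>(a, c). (k - 1 - a - c, c)" "\<lambda>(a, c). (k - 1 - a - c, c)"])
       (auto simp: cells_def)
  also have "\<dots> = form1 u v"
    unfolding form1_def FT sum_cells[of "\<lambda>a c. tri_form (u \<circ> T a c) (v \<circ> T a c)"] ..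
  finally show ?thesis .
qed

subsection \<open>Harmonic functions on the first graph\<close>

text \<open>The weak form of the mean value property: the first variation of the energy vanishes in
  every direction that keeps the boundary values.\<close>

definition harmonic1 :: "(complex \<Rightarrow> real) \<Rightarrow> bool" where
  "harmonic1 u \<longleftrightarrow> (\<forall>v. (\<forall>i<3. v (q i) = 0) \<longrightarrow> form1 u v = 0)"

lemma harmonic1_form1_cong: "harmonic1 u \<Longrightarrow> (\<And>i. i < 3 \<Longrightarrow> v (q i) = w (q i)) \<Longrightarrow> form1 u v = form1 u w"
proof -
  assume "harmonic1 u" "\<And>i. i < 3 \<Longrightarrow> v (q i) = w (q i)"
  then have "form1 u (\<lambda>x. v x - w x) = 0" unfolding harmonic1_def by auto
  then show ?thesis by (simp add: form1_diff_right)
qed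

lemma harmonic1_unique:
  assumes "harmonic1 u" "harmonic1 v" "\<And>i. i < 3 \<Longrightarrow> u (q i) = v (q i)" "n < d" "i < 3"
  shows "u (F k n (q i)) = v (F k n (q i))"
proof -
  have "form1 u (\<lambda>x. u x - v x) = 0" "form1 v (\<lambda>x. u x - v x) = 0"
    using assms(1-3) unfolding harmonic1_def by auto
  then have "energy1 (\<lambda>x. u x - v x) = 0"
    by (simp add: form1_linear_left flip: form1_self)
  from energy1_zero_imp_const[OF this assms(4,5)] assms(3)[of 0] show ?thesis by simp
qed

text \<open>Truncation to \<open>[0, 1]\<close> does not increase the energy, so it suffices to minimise over a
  product of compact intervals.\<close>
lemma harmonic_indicator_exists:
  assumes "j < 3"
  shows "\<exists>h. harmonic1 h \<and> (\<forall>i<3. h (q i) = (if i = j then 1 else 0)) \<and> (\<forall>x. 0 \<le> h x \<and> h x \<le> 1)"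
proof -
  define C where "C x = (if x = q j then {1} else if x \<in> V0 then {0} else {0..1::real})" for x
  define S where "S = Pi\<^sub>E UNIV C"
  \<comment> \<open>Tychonoff's theorem for functions on the whole plane. \<open>energy1\<close> is
    continuous for pointwise convergence because it reads only finitely many values.\<close>
  have "compactin (product_topology (\<lambda>_. euclidean) UNIV) S"
    unfolding S_def by (auto simp: compactin_PiE C_def)
  then have "compact S" by (simp add: euclidean_product_topology)
  moreover have "S \<noteq> {}" by (auto simp: S_def PiE_eq_empty_iff C_def split: if_splits)
  moreover have "continuous_on S energy1"
    unfolding energy1_def tri_energy_def comp_def
    by (intro continuous_intros continuous_on_subset[OF continuous_on_product_coordinates]) auto
  ultimately obtain h where h: "h \<in> S" "\<And>v. v \<in> S \<Longrightarrow> energy1 h \<le> energy1 v"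
    using continuous_attains_inf by metis
  have hq: "h (q i) = (if i = j then 1 else 0)" if "i < 3" for i
  proof -
    have "h (q i) \<in> C (q i)" using h(1) by (auto simp: S_def PiE_iff)
    then show ?thesis using that assms by (auto simp: C_def q_inj split: if_splits)
  qed
  have h01: "0 \<le> h x \<and> h x \<le> 1" for x
  proof -
    have "h x \<in> C x" using h(1) by (auto simp: S_def PiE_iff)
    then show ?thesis by (auto simp: C_def split: if_splits)
  qed
  have min: "energy1 h \<le> energy1 v" if v: "\<And>i. i < 3 \<Longrightarrow> v (q i) = (if i = j then 1 else 0)" for v
  proof -
    define clip where "clip t = max 0 (min 1 t)" for t :: real
    have "(clip s - clip t)\<^sup>2 \<le> (s - t)\<^sup>2" for s t
      by (subst abs_le_square_iff [symmetric]) (auto simp: clip_def)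
    then have "energy1 (clip \<circ> v) \<le> energy1 v"
      unfolding energy1_def tri_energy_def by (intro sum_mono add_mono) auto
    moreover have "clip \<circ> v \<in> S"
      using v assms by (auto simp: S_def C_def clip_def V0_eq)
    ultimately show ?thesis using h(2) by force
  qed
  have "harmonic1 h"
    unfolding harmonic1_def
  proof (intro allI impI)
    fix v :: "complex \<Rightarrow> real" assume v: "\<forall>i<3. v (q i) = 0"
    define b where "b = form1 h v"
    \<comment> \<open>Adding 1 keeps the divisor positive even if \<open>v\<close> has no energy.
      The choice of \<open>t\<close> minimises \<open>2 * t * b + t\<^sup>2 * D\<close>, with
      minimum \<open>- b\<^sup>2 / D\<close>.\<close>
    define D where "D = energy1 v + 1"
    have D: "D > 0" by (simp add: D_def add_nonneg_pos)
    define t where "t = - b / D"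
    have "energy1 h \<le> energy1 (\<lambda>x. h x + t * v x)"
      by (rule min) (use hq v in auto)
    also have "\<dots> = energy1 h + 2 * t * b + t\<^sup>2 * energy1 v"
      unfolding form1_self [symmetric] b_def
      by (simp add: form1_linear form1_commute[of v h] power2_eq_square algebra_simps)
    also have "\<dots> \<le> energy1 h + 2 * t * b + t\<^sup>2 * D"
      by (simp add: D_def algebra_simps)
    also have "\<dots> = energy1 h - b\<^sup>2 / D"
      using D by (simp add: t_def power2_eq_square field_simps)
    finally have "b\<^sup>2 / D \<le> 0" by simp
    then show "form1 h v = 0"
      using D by (simp add: b_def divide_le_0_iff)
  qed
  then show ?thesis using hq h01 by blast
qed

text \<open>Only the values at level-1 vertices are determined by harmonicity and boundary data;
  elsewhere the choice is arbitrary. The bounds carry the maximum principle into the later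
  estimates.\<close>

definition H :: "nat \<Rightarrow> complex \<Rightarrow> real" where
  "H j = (SOME h. harmonic1 h \<and> (\<forall>i<3. h (q i) = (if i = j then 1 else 0)) \<and> (\<forall>x. 0 \<le> h x \<and> h x \<le> 1))"

lemma H:
  assumes "j < 3"
  shows harmonic1_H: "harmonic1 (H j)" and H_q: "i < 3 \<Longrightarrow> H j (q i) = (if i = j then 1 else 0)"
    and H_nonneg: "0 \<le> H j x" and H_le_1: "H j x \<le> 1"
  using someI_ex[OF harmonic_indicator_exists[OF assms]] unfolding H_def by blast+

definition harm_ext :: "(nat \<Rightarrow> real) \<Rightarrow> complex \<Rightarrow> real" where
  "harm_ext u x = (\<Sum>j<3. u j * H j x)"

lemma harm_ext_q: "i < 3 \<Longrightarrow> harm_ext u (q i) = u i"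
  by (auto simp: harm_ext_def sum_less_3 less_3 H_q)

lemma form1_harm_ext_left: "form1 (harm_ext u) v = (\<Sum>j<3. u j * form1 (H j) v)"
  unfolding harm_ext_def[abs_def] sum_less_3 by (simp add: form1_linear)

lemma harmonic1_harm_ext: "harmonic1 (harm_ext u)"
  using harmonic1_H unfolding harmonic1_def by (simp add: form1_harm_ext_left)

text \<open>\<open>H 0 + H 1 + H 2\<close> has the boundary values of the constant 1, and a harmonic
  left argument sees only the boundary values of the right one.\<close>

lemma form1_H_row_sum: "i < 3 \<Longrightarrow> form1 (H i) (H 0) + form1 (H i) (H 1) + form1 (H i) (H 2) = 0"
proof -
  assume i: "i < 3"
  have "form1 (H i) (\<lambda>x. H 0 x + H 1 x + H 2 x) = form1 (H i) (\<lambda>_. 1)"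
    by (rule harmonic1_form1_cong[OF harmonic1_H[OF i]]) (auto simp: H_q less_3)
  then show ?thesis by (simp add: form1_linear)
qed

text \<open>An involution preserving the form and permuting the vertices carries harmonic functions
  to harmonic functions, so \<open>H i \<circ> S\<close> can replace \<open>H (s i)\<close> in the
  form.\<close>

lemma form1_H_symmetry:
  assumes B: "\<And>u v. form1 (u \<circ> S) (v \<circ> S) = form1 u v" and S: "\<And>z. S (S z) = z"
    and s: "\<And>i. i < 3 \<Longrightarrow> S (q i) = q (s i)" "\<And>i. i < 3 \<Longrightarrow> s i < 3 \<and> s (s i) = i"
    and ij: "i < 3" "j < 3"
  shows "form1 (H (s i)) (H (s j)) = form1 (H i) (H j)"
proof -
  have HS: "(H i \<circ> S) (q l) = H (s i) (q l)" if "i < 3" "l < 3" for i l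
    using that s by (auto simp: H_q)
  have harmonic1: "harmonic1 (H i \<circ> S)"
    unfolding harmonic1_def
  proof (intro allI impI)
    fix v :: "complex \<Rightarrow> real" assume v: "\<forall>i<3. v (q i) = 0"
    have "form1 (H i \<circ> S) v = form1 (H i \<circ> S) ((v \<circ> S) \<circ> S)" by (simp add: comp_def S)
    also have "\<dots> = form1 (H i) (v \<circ> S)" by (rule B)
    also have "\<dots> = 0" using harmonic1_H[OF ij(1)] v s unfolding harmonic1_def by auto
    finally show "form1 (H i \<circ> S) v = 0" .
  qed
  have "form1 (H i) (H j) = form1 (H i \<circ> S) (H j \<circ> S)" by (simp add: B)
  also have "\<dots> = form1 (H i \<circ> S) (H (s j))"
    by (rule harmonic1_form1_cong[OF harmonic1]) (use HS ij in auto)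
  also have "\<dots> = form1 (H (s j)) (H i \<circ> S)" by (rule form1_commute)
  also have "\<dots> = form1 (H (s j)) (H (s i))"
    by (rule harmonic1_form1_cong[OF harmonic1_H]) (use HS ij s in auto)
  finally show ?thesis by (simp add: form1_commute)
qed

section \<open>The scaling factor as trace of the level-1 form\<close>

definition renorm :: real where
  "renorm = - form1 (H 0) (H 1)"

text \<open>The two reflections make the off-diagonal entries equal and the zero row sums give the
  diagonal: the Gram matrix of the \<open>H i\<close> is \<open>renorm\<close> times that of the
  triangle energy.\<close>

lemma form1_H:
  "form1 (H 0) (H 1) = - renorm" "form1 (H 0) (H 2) = - renorm" "form1 (H 1) (H 2) = - renorm"
  "form1 (H 0) (H 0) = 2 * renorm" "form1 (H 1) (H 1) = 2 * renorm" "form1 (H 2) (H 2) = 2 * renorm"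
proof -
  show 1: "form1 (H 0) (H 1) = - renorm" by (simp add: renorm_def)
  define s where "s i = (if i = 1 then 2 else if i = 2 then 1 else i)" for i :: nat
  have "form1 (H (s 0)) (H (s 1)) = form1 (H 0) (H 1)"
    by (rule form1_H_symmetry[OF form1_swap12]) (auto simp: s_def less_3)
  then show 2: "form1 (H 0) (H 2) = - renorm" using 1 by (simp add: s_def)
  define t where "t i = (if i = 0 then 1 else if i = 1 then 0 else i)" for i :: nat
  have "form1 (H (t 0)) (H (t 2)) = form1 (H 0) (H 2)"
    by (rule form1_H_symmetry[OF form1_swap01]) (auto simp: t_def less_3)
  then show 3: "form1 (H 1) (H 2) = - renorm" using 2 by (simp add: t_def)
  show "form1 (H 0) (H 0) = 2 * renorm" "form1 (H 1) (H 1) = 2 * renorm" "form1 (H 2) (H 2) = 2 * renorm"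
    using form1_H_row_sum[of 0] form1_H_row_sum[of 1] form1_H_row_sum[of 2] 1 2 3
      form1_commute[of "H 1" "H 0"] form1_commute[of "H 2" "H 0"] form1_commute[of "H 2" "H 1"] by auto
qed

lemma energy1_harm_ext: "energy1 (harm_ext u) = renorm * vec_energy u"
proof -
  have "energy1 (harm_ext u) = (\<Sum>i<3. u i * (\<Sum>j<3. u j * form1 (H j) (H i)))"
    unfolding form1_self[symmetric] form1_harm_ext_left by (simp add: form1_commute[of _ "harm_ext u"] form1_harm_ext_left)
  also have "\<dots> = renorm * vec_energy u"
    using form1_H form1_commute[of "H 1" "H 0"] form1_commute[of "H 2" "H 0"] form1_commute[of "H 2" "H 1"]
    by (simp add: sum_less_3 vec_energy_def power2_eq_square algebra_simps)
  finally show ?thesis .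
qed

text \<open>Pythagoras: the remainder vanishes at the three vertices and is therefore orthogonal to
  the harmonic extension.\<close>

lemma energy1_split: "energy1 v = renorm * tri_energy v + energy1 (\<lambda>x. v x - harm_ext (\<lambda>i. v (q i)) x)"
proof -
  let ?h = "harm_ext (\<lambda>i. v (q i))"
  have "form1 ?h (\<lambda>x. v x - ?h x) = 0"
    using harmonic1_harm_ext[of "\<lambda>i. v (q i)"] by (auto simp: harmonic1_def harm_ext_q)
  then have "form1 v ?h = form1 ?h ?h" by (simp add: form1_diff_right form1_commute[of v])
  then show ?thesis
    by (simp add: form1_linear form1_commute[of ?h v] flip: tri_energy_eq_vec_energy energy1_harm_ext form1_self)
       (simp add: form1_self energy1_harm_ext tri_energy_eq_vec_energy)
qed

lemma energy1_ge: "renorm * tri_energy v \<le> energy1 v"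
  using energy1_split[of v] by simp

lemma energy1_eq_imp_harm_ext:
  assumes "energy1 v = renorm * tri_energy v" "n < d" "i < 3"
  shows "v (F k n (q i)) = harm_ext (\<lambda>i. v (q i)) (F k n (q i))"
proof -
  have "energy1 (\<lambda>x. v x - harm_ext (\<lambda>i. v (q i)) x) = 0" using energy1_split[of v] assms(1) by simp
  from energy1_zero_imp_const[OF this assms(2,3)] show ?thesis by (simp add: harm_ext_q)
qed

lemma renorm_pos: "0 < renorm"
proof -
  have "energy1 (H 0) = 2 * renorm" using form1_H(4) by (simp add: form1_self)
  moreover have "energy1 (H 0) \<noteq> 0"
  proof
    assume "energy1 (H 0) = 0"
    from energy1_zero_imp_const[OF this corner(1), of 1 1] show False
      using corner(2)[of 1] by (simp add: H_q)
  qed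
  ultimately show ?thesis using energy1_nonneg[of "H 0"] by linarith
qed

lemma indicator_q_cell:
  assumes "j < 3" "n < d" "i < 3"
  shows "F k n (q i) = q j \<longleftrightarrow> n = corner j \<and> i = j"
  using corner_unique[of j n "q i"] corner[of j] assms by (auto simp: q_inj)

text \<open>The indicator of \<open>q 0\<close> has energy 2 on both levels, since
  \<open>q 0\<close> lies in a single level-1 cell and has two neighbours there.\<close>

lemma renorm_le_1: "renorm \<le> 1"
proof -
  let ?v = "\<lambda>x. of_bool (x = q 0) :: real"
  have "tri_energy (?v \<circ> F k n) = (if n = corner 0 then 2 else 0)" if "n < d" for n
    using that by (simp add: tri_energy_def indicator_q_cell)
  then have "energy1 ?v = (\<Sum>n<d. if n = corner 0 then 2 else 0)"
    unfolding energy1_def by (intro sum.cong) auto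
  also have "\<dots> = 2" using corner(1)[of 0] by simp
  finally have "renorm * tri_energy ?v \<le> 2" using energy1_ge[of ?v] by simp
  then show ?thesis by (simp add: tri_energy_def q_inj)
qed

lemma rk_eq: "rk k = renorm"
  unfolding rk_def
proof (rule the_equality, safe)
  show "0 < renorm" by (rule renorm_pos)
next
  fix u
  show "\<exists>v. (\<forall>x\<in>V0. v x = u x) \<and> Em k renorm 1 v = Em k renorm 0 u"
    using renorm_pos
    by (intro exI[of _ "harm_ext (\<lambda>i. u (q i))"]) (auto simp: V0_eq harm_ext_q Em_0 Em_1 energy1_harm_ext tri_energy_eq_vec_energy)
next
  fix u v :: "complex \<Rightarrow> real" assume "\<forall>x\<in>V0. v x = u x"
  then have "tri_energy v = tri_energy u" by (intro tri_energy_cong) auto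
  then show "Em k renorm 0 u \<le> Em k renorm 1 v"
    using energy1_ge[of v] renorm_pos by (simp add: Em_0 Em_1 field_simps)
next
  fix r :: real assume r: "0 < r"
    and all: "\<forall>u. (\<exists>v. (\<forall>x\<in>V0. v x = u x) \<and> Em k r 1 v = Em k r 0 u) \<and>
          (\<forall>v. (\<forall>x\<in>V0. v x = u x) \<longrightarrow> Em k r 0 u \<le> Em k r 1 v)"
  \<comment> \<open>Uniqueness is tested on \<open>H 0\<close> alone: the extension attaining the
    minimum gives \<open>renorm \<le> r\<close>, and \<open>H 0\<close> as its own competitor gives
    \<open>r \<le> renorm\<close>.\<close>
  have two: "tri_energy (H 0) = 2" by (simp add: tri_energy_def H_q)
  obtain v where v: "\<forall>x\<in>V0. v x = H 0 x" "Em k r 1 v = Em k r 0 (H 0)" using all by blast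
  have "tri_energy v = 2" using v(1) tri_energy_cong[of v "H 0"] two by simp
  then have "2 * renorm \<le> 2 * r" using v(2) energy1_ge[of v] r two by (simp add: Em_0 Em_1 field_simps)
  moreover have "Em k r 0 (H 0) \<le> Em k r 1 (H 0)" using all by blast
  then have "2 * r \<le> 2 * renorm" using r two form1_H(4) by (simp add: Em_0 Em_1 form1_self field_simps)
  ultimately show "r = renorm" by simp
qed

section \<open>Energy loss from a cell to its subcells\<close>

definition cell_values :: "nat \<Rightarrow> (nat \<Rightarrow> real) \<Rightarrow> nat \<Rightarrow> real" where
  "cell_values n u i = harm_ext u (F k n (q i))"

lemma sum_vec_energy_cell_values: "(\<Sum>n<d. vec_energy (cell_values n u)) = renorm * vec_energy u"
  by (simp add: cell_values_def[abs_def] energy1_def tri_energy_eq_vec_energy flip: energy1_harm_ext)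

text \<open>The flux of a harmonic function through \<open>q j\<close> only involves the corner cell at \<open>q j\<close>, the
  fluxes add up to zero, and the energy is the sum of the fluxes weighted by the boundary values.
  Hence two corner cells other than a given cell carry a definite share of the energy.\<close>
lemma vec_energy_cell_values_le:
  assumes n: "n < d"
  shows "vec_energy (cell_values n u) \<le> renorm * (1 - renorm / 2) * vec_energy u"
proof -
  define h where "h = harm_ext u"
  define Q where "Q n = vec_energy (cell_values n u)" for n
  \<comment> \<open>The indicator of a vertex as test function: \<open>\<phi> j\<close> is the net
    flux of \<open>h\<close> at \<open>q j\<close>.\<close>
  define ind where "ind j x = (of_bool (x = q j) :: real)" for j x
  define \<phi> where "\<phi> j = form1 h (ind j)" for j
  have harmonic1: "harmonic1 h" by (simp add: h_def harmonic1_harm_ext)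
  have flux: "(\<phi> j)\<^sup>2 \<le> 2 * Q (corner j)" if j: "j < 3" for j
  proof -
    have "tri_form (h \<circ> F k n) (ind j \<circ> F k n) = 0" if "n < d" "n \<noteq> corner j" for n
      using that j by (simp add: tri_form_def ind_def indicator_q_cell)
    then have "\<phi> j = (\<Sum>n<d. if n = corner j then tri_form (h \<circ> F k n) (ind j \<circ> F k n) else 0)"
      unfolding \<phi>_def form1_def by (intro sum.cong) auto
    also have "\<dots> = tri_form (h \<circ> F k (corner j)) (ind j \<circ> F k (corner j))"
      using corner(1)[OF j] by simp
    finally have eq: "\<phi> j = tri_form (h \<circ> F k (corner j)) (ind j \<circ> F k (corner j))" .
    \<comment> \<open>The flux is a sum of two edge differences \<open>s + t\<close> in the corner
      cell; \<open>e\<close> is the difference along the third edge.\<close>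
    have sq: "(s + t)\<^sup>2 \<le> 2 * (s\<^sup>2 + t\<^sup>2 + e\<^sup>2)" for s t e :: real
      using sum_squares_bound[of s t] by (simp add: power2_sum) (smt (verit) zero_le_power2)
    have "(\<phi> j)\<^sup>2 \<le> 2 * tri_energy (h \<circ> F k (corner j))"
      unfolding eq using j corner(1)[OF j]
      using sq[of "h (F k (corner j) (q 0)) - h (F k (corner j) (q 1))"
          "h (F k (corner j) (q 0)) - h (F k (corner j) (q 2))"
          "h (F k (corner j) (q 1)) - h (F k (corner j) (q 2))"]
        sq[of "h (F k (corner j) (q 1)) - h (F k (corner j) (q 0))"
          "h (F k (corner j) (q 1)) - h (F k (corner j) (q 2))"
          "h (F k (corner j) (q 0)) - h (F k (corner j) (q 2))"]
        sq[of "h (F k (corner j) (q 2)) - h (F k (corner j) (q 0))"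
          "h (F k (corner j) (q 2)) - h (F k (corner j) (q 1))"
          "h (F k (corner j) (q 0)) - h (F k (corner j) (q 1))"]
      unfolding less_3[of j]
      by (elim disjE; simp add: tri_form_def tri_energy_def ind_def indicator_q_cell power2_commute add_ac)
    then show ?thesis by (simp add: Q_def tri_energy_eq_vec_energy cell_values_def[abs_def] h_def)
  qed
  have "form1 h (\<lambda>x. ind 0 x + ind 1 x + ind 2 x) = form1 h (\<lambda>_. 1)"
    by (rule harmonic1_form1_cong[OF harmonic1]) (auto simp: ind_def less_3 q_inj)
  then have sum0: "\<phi> 0 + \<phi> 1 + \<phi> 2 = 0" by (simp add: form1_linear \<phi>_def)
  have "form1 h h = form1 h (\<lambda>x. u 0 * ind 0 x + u 1 * ind 1 x + u 2 * ind 2 x)"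
    by (rule harmonic1_form1_cong[OF harmonic1]) (auto simp: ind_def less_3 q_inj harm_ext_q h_def)
  then have energy: "u 0 * \<phi> 0 + u 1 * \<phi> 1 + u 2 * \<phi> 2 = renorm * vec_energy u"
    by (simp add: form1_linear \<phi>_def form1_self) (simp add: h_def energy1_harm_ext)
  \<comment> \<open>At most one corner cell equals \<open>n\<close>, so some vertex \<open>i\<close>
    leaves \<open>n\<close> distinct from the corner cells at the other two vertices
    \<open>j\<close> and \<open>l\<close>. The zero sum of the fluxes then eliminates
    \<open>\<phi> i\<close>.\<close>
  have core: ?thesis if ijl: "i < 3" "j < 3" "l < 3" "i \<noteq> j" "i \<noteq> l" "j \<noteq> l"
    and nc: "n \<noteq> corner j" "n \<noteq> corner l" for i j l
  proof -
    have "corner j \<noteq> corner l" using corner_inj ijl by blast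
    then have "Q n + Q (corner j) + Q (corner l) = sum Q {n, corner j, corner l}" using nc by simp
    also have "\<dots> \<le> (\<Sum>n<d. Q n)"
      by (rule sum_mono2) (use n corner ijl in \<open>auto simp: Q_def\<close>)
    also have "\<dots> = renorm * vec_energy u" by (simp add: Q_def sum_vec_energy_cell_values)
    finally have Q: "Q n + (Q (corner j) + Q (corner l)) \<le> renorm * vec_energy u" by simp
    define a b where "a = u j - u i" and "b = u l - u i"
    have "\<phi> i + \<phi> j + \<phi> l = 0" "u i * \<phi> i + u j * \<phi> j + u l * \<phi> l = renorm * vec_energy u"
      using sum0 energy ijl unfolding less_3 by (auto simp: algebra_simps)
    moreover from this have "\<phi> i = - \<phi> j - \<phi> l" by simp
    ultimately have e: "renorm * vec_energy u = a * \<phi> j + b * \<phi> l"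
      by (simp add: a_def b_def algebra_simps)
    have ab: "a\<^sup>2 + b\<^sup>2 \<le> vec_energy u"
      using ijl unfolding less_3 by (auto simp: vec_energy_def a_def b_def power2_commute)
    \<comment> \<open>Cauchy-Schwarz by Lagrange's identity: the defect is exactly the square
      \<open>(a * \<phi> l - b * \<phi> j)\<^sup>2\<close>.\<close>
    have "(renorm * vec_energy u)\<^sup>2 \<le> (a\<^sup>2 + b\<^sup>2) * ((\<phi> j)\<^sup>2 + (\<phi> l)\<^sup>2)"
      unfolding e using zero_le_power2[of "a * \<phi> l - b * \<phi> j"]
      by (simp add: power2_eq_square algebra_simps)
    also have "\<dots> \<le> vec_energy u * (2 * Q (corner j) + 2 * Q (corner l))"
      by (intro mult_mono add_mono flux ab ijl) auto
    finally have "vec_energy u * (renorm\<^sup>2 * vec_energy u) \<le> vec_energy u * (2 * (Q (corner j) + Q (corner l)))"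
      by (simp add: power2_eq_square algebra_simps)
    then have "renorm\<^sup>2 * vec_energy u \<le> 2 * (Q (corner j) + Q (corner l))"
      using vec_energy_nonneg[of u] by (cases "vec_energy u = 0") (auto simp: Q_def)
    moreover have "x \<le> y - s / 2" if "s \<le> 2 * t" "x + t \<le> y" for s t x y :: real
      using that by linarith
    ultimately have "Q n \<le> renorm * vec_energy u - renorm\<^sup>2 * vec_energy u / 2" using Q by blast
    then show ?thesis by (simp add: Q_def power2_eq_square algebra_simps)
  qed
  show ?thesis
  proof (cases "n = corner 0")
    case True
    then have "n \<noteq> corner 1" "n \<noteq> corner 2" using corner_inj[of 0 1] corner_inj[of 0 2] by auto
    then show ?thesis using core[of 0 1 2] by simp
  next
    case n0: False
    show ?thesis
    proof (cases "n = corner 1")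
      case True
      then have "n \<noteq> corner 2" using corner_inj[of 1 2] by auto
      then show ?thesis using core[of 1 0 2] n0 by simp
    next
      case False
      then show ?thesis using core[of 2 0 1] n0 by simp
    qed
  qed
qed

text \<open>The contraction factor after normalisation by \<open>renorm\<close> per level; the
  unnormalised energy shrinks at least as fast because \<open>renorm \<le> 1\<close>.\<close>

definition theta :: real where "theta = 1 - renorm / 2"

lemma theta: "0 < theta" "theta < 1"
  using renorm_pos renorm_le_1 by (auto simp: theta_def)

subsection \<open>The gasket\<close>

definition approx :: "nat \<Rightarrow> complex set" where
  "approx m = (\<Union>w\<in>words k m. Fw k w ` closed_tri)"

lemma approx_0: "approx 0 = closed_tri"
  by (simp add: approx_def)

lemma approx_Suc: "approx (Suc m) = (\<Union>n<d. F k n ` approx m)"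
  unfolding approx_def words_Suc_Cons by (auto simp: image_iff) blast+

lemma approx_decseq: "decseq approx"
proof (rule decseq_SucI)
  fix m show "approx (Suc m) \<subseteq> approx m"
    unfolding approx_def words_Suc_snoc using F_triangle by (fastforce simp: Fw_snoc)
qed

lemma compact_approx: "compact (approx m)"
  unfolding approx_def
  by (intro compact_UN compact_continuous_image continuous_on_Fw compact_triangle) auto

lemma q_in_approx: "i < 3 \<Longrightarrow> q i \<in> approx m"
proof (induction m)
  case (Suc m)
  then have "F k (corner i) (q i) \<in> approx (Suc m)"
    unfolding approx_Suc using corner(1) by blast
  then show ?case using corner(2) Suc.prems by simp
qed (simp add: approx_0)

definition attractor :: "complex set" where
  "attractor = (\<Inter>m. approx m)"

lemma attractor_fixed: "attractor = (\<Union>n<d. F k n ` attractor)"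
proof (intro equalityI subsetI)
  fix x assume x: "x \<in> attractor"
  have "\<exists>n<d. x \<in> F k n ` approx m" for m
    using x approx_Suc[of m] unfolding attractor_def by blast
  then obtain f where f: "\<And>m. f m < d" "\<And>m. x \<in> F k (f m) ` approx m" by metis
  \<comment> \<open>The first letter may depend on the level. A letter used for infinitely many
    levels, together with injectivity of its map, yields one preimage \<open>y\<close>; monotonicity
    of \<open>approx\<close> supplies the remaining levels.\<close>
  obtain n where n: "n < d" "infinite {m. f m = n}"
  proof -
    have "finite (range f)" using f(1) by (meson finite_lessThan finite_subset image_subsetI lessThan_iff)
    then show ?thesis using pigeonhole_infinite[of "UNIV :: nat set" f] f(1) that by auto
  qed
  have "{m. f m = n} \<noteq> {}" using n(2) by (metis finite.emptyI)
  then obtain y where y: "x = F k n y" using f(2) by blast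
  have "y \<in> approx m" for m
  proof -
    obtain m' where m': "m' \<ge> m" "f m' = n"
      using n(2) unfolding infinite_nat_iff_unbounded_le by auto
    then have "y \<in> approx m'" using f(2)[of m'] y by (auto simp: F_inj)
    then show ?thesis using decseqD[OF approx_decseq m'(1)] by auto
  qed
  then show "x \<in> (\<Union>n<d. F k n ` attractor)"
    using y n(1) unfolding attractor_def by blast
next
  fix x assume "x \<in> (\<Union>n<d. F k n ` attractor)"
  then obtain n y where ny: "n < d" "x = F k n y" "\<And>m. y \<in> approx m"
    unfolding attractor_def by blast
  then have "x \<in> approx (Suc m)" for m unfolding approx_Suc by blast
  then have "x \<in> approx m" for m using decseqD[OF approx_decseq, of m "Suc m"] by auto
  then show "x \<in> attractor" unfolding attractor_def by blast
qed

lemma attractor_compact: "compact attractor"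
proof -
  have "attractor = approx 0 \<inter> (\<Inter>m. approx m)" by (auto simp: attractor_def)
  moreover have "closed (\<Inter>m. approx m)" using compact_approx by (intro closed_INT) (auto simp: compact_imp_closed)
  ultimately show ?thesis using compact_approx by (simp add: compact_Int_closed)
qed

lemma fixed_words:
  assumes "X = (\<Union>n<d. F k n ` X)"
  shows "X = (\<Union>w\<in>words k m. Fw k w ` X)"
proof (induction m)
  case (Suc m)
  have "(\<Union>w\<in>words k (Suc m). Fw k w ` X) = (\<Union>n<d. F k n ` (\<Union>w\<in>words k m. Fw k w ` X))"
    unfolding words_Suc_Cons by (auto simp: image_iff) blast+
  then show ?case using Suc.IH assms by simp
qed simp

lemma geometric_k_small:
  assumes "0 < e" shows "\<exists>m. C / real k ^ m < e"
proof -
  have "(\<lambda>m. C * (1 / real k) ^ m) \<longlonglongrightarrow> C * 0"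
    using k_ge2 by (intro tendsto_mult tendsto_const LIMSEQ_power_zero) auto
  then have "\<forall>\<^sub>F m in sequentially. C * (1 / real k) ^ m < e"
    using assms by (intro order_tendstoD) auto
  then show ?thesis
    by (auto simp: eventually_sequentially power_one_over)
qed

text \<open>Near a point of \<open>X\<close> in the cell of \<open>w\<close> lies the image under
  the same \<open>Fw k w\<close> of any point of \<open>Y\<close>, at distance at most
  \<open>C / k^m\<close>. Applied in both directions this gives uniqueness of the attractor.\<close>

lemma compact_fixed_subset:
  assumes "compact X" "X = (\<Union>n<d. F k n ` X)" "compact Y" "Y \<noteq> {}" "Y = (\<Union>n<d. F k n ` Y)"
  shows "X \<subseteq> Y"
proof
  fix x assume x: "x \<in> X"
  obtain y where y: "y \<in> Y" using assms by blast
  have "bounded (X \<union> Y)" using assms compact_imp_bounded by auto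
  then obtain C where C: "\<And>a b. a \<in> X \<union> Y \<Longrightarrow> b \<in> X \<union> Y \<Longrightarrow> dist a b \<le> C"
    unfolding bounded_two_points by blast
  have "\<exists>z\<in>Y. dist z x < e" if "0 < e" for e
  proof -
    obtain m where m: "C / real k ^ m < e" using geometric_k_small[OF \<open>0 < e\<close>] by blast
    obtain w x' where w: "w \<in> words k m" "x = Fw k w x'" "x' \<in> X"
      using x fixed_words[OF assms(2), of m] by blast
    have "Fw k w y \<in> Y" using fixed_words[OF assms(5), of m] w(1) y by blast
    moreover have "dist (Fw k w y) x \<le> C / real k ^ m"
      unfolding w dist_Fw[OF w(1)] using C[of y x'] w(3) y by (intro divide_right_mono) auto
    ultimately show ?thesis using m by force
  qed
  then have "x \<in> closure Y" by (simp add: closure_approachable)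
  then show "x \<in> Y" using assms(3) by (simp add: compact_imp_closed)
qed

lemma SG_eq_attractor: "SG k = attractor"
  unfolding SG_def
proof (rule the_equality)
  have ne: "attractor \<noteq> {}" using q_in_approx[of 0] unfolding attractor_def by auto
  then show "compact attractor \<and> attractor \<noteq> {} \<and> attractor = (\<Union>n<d. F k n ` attractor)"
    using attractor_compact attractor_fixed by blast
  fix X assume "compact X \<and> X \<noteq> {} \<and> X = (\<Union>n<d. F k n ` X)"
  then show "X = attractor"
    using compact_fixed_subset[of X attractor] compact_fixed_subset[of attractor X]
      attractor_compact attractor_fixed ne by blast
qed

lemma SG_compact: "compact (SG k)"
  using attractor_compact by (simp add: SG_eq_attractor)

lemma SG_fixed: "SG k = (\<Union>n<d. F k n ` SG k)"
  using attractor_fixed by (simp add: SG_eq_attractor)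

lemma SG_words: "SG k = (\<Union>w\<in>words k m. Fw k w ` SG k)"
  using fixed_words[OF SG_fixed] .

lemma SG_subset_closed_tri: "SG k \<subseteq> closed_tri"
  using approx_0 unfolding SG_eq_attractor attractor_def by auto

lemma q_in_SG [simp]: "i < 3 \<Longrightarrow> q i \<in> SG k"
  using q_in_approx unfolding SG_eq_attractor attractor_def by auto

lemma F_in_SG: "n < d \<Longrightarrow> x \<in> SG k \<Longrightarrow> F k n x \<in> SG k"
  using SG_fixed by blast

lemma Fw_in_SG: "w \<in> words k m \<Longrightarrow> x \<in> SG k \<Longrightarrow> Fw k w x \<in> SG k"
  using SG_words[of m] by blast

lemma SG_F_cases:
  assumes "x \<in> SG k" obtains n y where "n < d" "y \<in> SG k" "x = F k n y"
  using assms SG_fixed by blast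

lemma SG_Fw_cases:
  assumes "x \<in> SG k" obtains w y where "w \<in> words k m" "y \<in> SG k" "x = Fw k w y"
  using assms SG_words[of m] by blast

lemma dist_closed_tri: "x \<in> closed_tri \<Longrightarrow> y \<in> closed_tri \<Longrightarrow> dist x y \<le> 4"
  using triangle_norm_le[of x] triangle_norm_le[of y] norm_triangle_ineq4[of x y] by (simp add: dist_norm)

lemma dist_in_cell:
  "w \<in> words k m \<Longrightarrow> x \<in> Fw k w ` SG k \<Longrightarrow> y \<in> Fw k w ` SG k \<Longrightarrow> dist x y \<le> 4 / real k ^ m"
  using dist_closed_tri SG_subset_closed_tri by (auto simp: dist_Fw intro!: divide_right_mono) blast

lemma cells_meet_finite:
  assumes "w \<in> words k m" "w' \<in> words k m" "w \<noteq> w'"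
  shows "finite (Fw k w ` SG k \<inter> Fw k w' ` SG k)"
proof (rule finite_subset)
  show "Fw k w ` SG k \<inter> Fw k w' ` SG k \<subseteq> Fw k w ` V0"
    using words_meet(1)[OF assms] SG_subset_closed_tri by blast
qed (simp add: V0_def)

text \<open>In lattice coordinates a level-\<open>m\<close> cell containing \<open>x\<close> has corner \<open>(a, c)\<close> with
  \<open>a \<le> k\<^sup>m cx x \<le> a + 1\<close> and likewise for \<open>c\<close>.\<close>
lemma card_words_containing:
  "card {w\<in>words k m. x \<in> Fw k w ` SG k} \<le> 4"
proof -
  let ?W = "{w\<in>words k m. x \<in> Fw k w ` SG k}"
  define A where "A s = {a::nat. real a \<le> s \<and> s \<le> real a + 1}" for s :: real
  have A: "finite (A s) \<and> card (A s) \<le> 2" for s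
  proof -
    have "A s \<subseteq> {nat \<lfloor>s\<rfloor>, nat \<lfloor>s\<rfloor> - 1}"
      unfolding A_def by (auto simp: le_nat_iff floor_eq_iff) linarith
    moreover have "card {nat \<lfloor>s\<rfloor>, nat \<lfloor>s\<rfloor> - 1} \<le> 2" by (simp add: card_insert_if)
    ultimately show ?thesis
      by (meson card_mono dual_order.trans finite.emptyI finite_insert finite_subset)
  qed
  let ?f = "\<lambda>w. (word_coord k (cell_col k) w, word_coord k (cell_row k) w)"
  have "inj_on ?f ?W" using word_eqI by (auto simp: inj_on_def)
  moreover have "?f ` ?W \<subseteq> A (cx x * real k ^ m) \<times> A (cy x * real k ^ m)"
  proof
    fix z assume "z \<in> ?f ` ?W"
    then obtain w y where w: "w \<in> words k m" "x = Fw k w y" "y \<in> closed_tri" "z = ?f w"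
      using SG_subset_closed_tri by blast
    then have "length w = m" by (simp add: words_def)
    then show "z \<in> A (cx x * real k ^ m) \<times> A (cy x * real k ^ m)"
      using w k_pos by (auto simp: A_def cx_Fw cy_Fw closed_tri_def)
  qed
  ultimately have "card ?W \<le> card (A (cx x * real k ^ m) \<times> A (cy x * real k ^ m))"
    using A by (intro card_inj_on_le) auto
  also have "\<dots> \<le> 2 * 2" unfolding card_cartesian_product using A by (intro mult_le_mono) auto
  finally show ?thesis by simp
qed

definition unit_vec :: "nat \<Rightarrow> nat \<Rightarrow> real" where
  "unit_vec j i = (if i = j then 1 else 0)"

lemma sum_unit_vec: "i < 3 \<Longrightarrow> (\<Sum>j<3. g j * unit_vec j i) = g i" "i < 3 \<Longrightarrow> (\<Sum>j<3. unit_vec i j * g j) = g i"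
  "i < 3 \<Longrightarrow> (\<Sum>j<3. unit_vec j i * g j) = g i"
  by (auto simp: unit_vec_def sum_less_3 less_3)

lemma vec_energy_unit_vec: "i < 3 \<Longrightarrow> vec_energy (unit_vec i) = 2"
  by (auto simp: vec_energy_def unit_vec_def less_3)

lemma H_sum: "n < d \<Longrightarrow> i < 3 \<Longrightarrow> (\<Sum>j<3. H j (F k n (q i))) = 1"
proof -
  assume ni: "n < d" "i < 3"
  have "harm_ext (\<lambda>_. 1) (F k n (q i)) = 1"
    by (rule harmonic1_unique[OF harmonic1_harm_ext _ _ ni, of "\<lambda>_. 1"])
       (auto simp: harmonic1_def harm_ext_q form1_commute[of "\<lambda>_. 1"])
  then show ?thesis by (simp add: harm_ext_def)
qed

lemma cell_values_eq: "cell_values n u i = (\<Sum>j<3. u j * H j (F k n (q i)))"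
  by (simp add: cell_values_def harm_ext_def)

lemma cell_values_cong: "(\<And>j. j < 3 \<Longrightarrow> u j = v j) \<Longrightarrow> cell_values n u = cell_values n v"
  by (simp add: cell_values_eq fun_eq_iff)

lemma cell_values_diff:
  "n < d \<Longrightarrow> i < 3 \<Longrightarrow> cell_values n u i - c = (\<Sum>j<3. (u j - c) * H j (F k n (q i)))"
  using H_sum[of n i] by (simp add: cell_values_eq left_diff_distrib sum_subtractf flip: sum_distrib_left)

lemma vec_energy_cell_values_theta: "n < d \<Longrightarrow> vec_energy (cell_values n u) \<le> theta * vec_energy u"
proof -
  assume "n < d"
  then have "vec_energy (cell_values n u) \<le> renorm * (theta * vec_energy u)"
    using vec_energy_cell_values_le[of n u] by (simp add: theta_def mult.assoc)
  also have "\<dots> \<le> 1 * (theta * vec_energy u)"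
    using renorm_le_1 theta by (intro mult_right_mono) auto
  finally show ?thesis by simp
qed

lemma abs_diff_le_sqrt_vec_energy: "i < 3 \<Longrightarrow> j < 3 \<Longrightarrow> \<bar>u i - u j\<bar> \<le> sqrt (vec_energy u)"
  by (rule real_le_rsqrt) (auto simp: less_3 vec_energy_def power2_commute)

subsection \<open>Continuous harmonic functions\<close>

definition bary :: "nat \<Rightarrow> complex \<Rightarrow> real" where
  "bary j x = (if j = 0 then 1 - cx x - cy x else if j = 1 then cx x else cy x)"

text \<open>Affine interpolation of the harmonic values on level-m cells, built by refining from the
  outermost letter. \<open>SOME\<close> picks one address for a point shared by several
  cells.\<close>

primrec pl_approx :: "nat \<Rightarrow> nat \<Rightarrow> complex \<Rightarrow> real" where
  "pl_approx 0 j x = bary j x"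
| "pl_approx (Suc m) j x =
    (let (n, y) = (SOME (n, y). n < d \<and> y \<in> SG k \<and> x = F k n y)
     in \<Sum>i<3. H j (F k n (q i)) * pl_approx m i y)"

text \<open>Independence of the chosen address: a point with two addresses is a vertex in both
  cells, where the sum collapses to \<open>H j\<close> at that point. The vertex values of level
  \<open>m\<close> are assumed because they are established by an induction that uses this
  lemma.\<close>

lemma pl_approx_Suc_aux:
  assumes pl_approx_q: "\<And>i j. i < 3 \<Longrightarrow> j < 3 \<Longrightarrow> pl_approx m j (q i) = unit_vec j i"
    and n: "n < d" and y: "y \<in> SG k"
  shows "pl_approx (Suc m) j (F k n y) = (\<Sum>i<3. H j (F k n (q i)) * pl_approx m i y)"
proof -
  have "\<exists>ny. case ny of (n', y') \<Rightarrow> n' < d \<and> y' \<in> SG k \<and> F k n y = F k n' y'"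
    using n y by (intro exI[of _ "(n, y)"]) auto
  from someI_ex[OF this] obtain n' y' where
    s: "(SOME (n', y'). n' < d \<and> y' \<in> SG k \<and> F k n y = F k n' y') = (n', y')"
    and n': "n' < d" "y' \<in> SG k" "F k n y = F k n' y'"
    by auto
  have eq: "pl_approx (Suc m) j (F k n y) = (\<Sum>i<3. H j (F k n' (q i)) * pl_approx m i y')"
    by (simp add: s)
  show ?thesis
  proof (cases "n = n'")
    case True
    then show ?thesis using n'(3) eq by (simp add: F_inj)
  next
    case False
    have T: "y \<in> closed_tri" "y' \<in> closed_tri" using y n' SG_subset_closed_tri by auto
    obtain l l' where l: "y = q l" "y' = q l'" "l < 3" "l' < 3"
      using cells_meet[OF n n'(1) False T n'(3)] by (auto simp: V0_eq)
    show ?thesis unfolding eq using l n'(3) by (simp add: pl_approx_q sum_unit_vec)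
  qed
qed

lemma pl_approx_q: "i < 3 \<Longrightarrow> j < 3 \<Longrightarrow> pl_approx m j (q i) = unit_vec j i"
proof (induction m arbitrary: i j)
  case 0
  then show ?case by (auto simp: bary_def unit_vec_def less_3)
next
  case (Suc m)
  have "pl_approx (Suc m) j (F k (corner i) (q i)) = (\<Sum>l<3. H j (F k (corner i) (q l)) * unit_vec l i)"
    using Suc by (subst pl_approx_Suc_aux) (auto simp: corner intro!: sum.cong)
  then show ?case using Suc.prems by (simp add: corner(2) sum_unit_vec H_q del: pl_approx.simps) (simp add: unit_vec_def)
qed

lemma pl_approx_Suc:
  "n < d \<Longrightarrow> y \<in> SG k \<Longrightarrow> pl_approx (Suc m) j (F k n y) = (\<Sum>i<3. H j (F k n (q i)) * pl_approx m i y)"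
  using pl_approx_Suc_aux pl_approx_q by blast

lemma continuous_on_pl_approx: "continuous_on (SG k) (pl_approx m j)"
proof (induction m arbitrary: j)
  case 0
  show ?case
    by (cases "j = 0"; cases "j = 1") (auto simp: bary_def[abs_def] intro!: continuous_intros)
next
  case (Suc m)
  \<comment> \<open>The inverse of \<open>F k n\<close>; the pieces are glued along the finite cover
    by closed cells.\<close>
  define G where "G n x = of_nat k * (x - sg_b k n)" for n x
  have GF: "G n (F k n y) = y" for n y using k_pos by (simp add: G_def F_def)
  have "continuous_on (\<Union>n\<in>{..<d}. F k n ` SG k) (pl_approx (Suc m) j)"
  proof (rule continuous_on_closed_Union)
    fix n assume n: "n \<in> {..<d}"
    show "closed (F k n ` SG k)"
      by (intro compact_imp_closed compact_continuous_image continuous_on_F SG_compact)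
    have "continuous_on (F k n ` SG k) (\<lambda>x. \<Sum>i<3. H j (F k n (q i)) * pl_approx m i (G n x))"
      by (intro continuous_intros continuous_on_compose2[OF Suc])
         (auto simp: GF, auto simp: G_def intro!: continuous_intros)
    then show "continuous_on (F k n ` SG k) (pl_approx (Suc m) j)"
      by (rule continuous_on_cong[THEN iffD1, rotated -1])
         (use n in \<open>auto simp: GF pl_approx_Suc simp del: pl_approx.simps\<close>)
  qed simp
  then show ?case using SG_fixed by simp
qed

lemma bary_osc:
  assumes "x \<in> closed_tri" shows "\<bar>(\<Sum>j<3. u j * bary j x) - u 0\<bar> \<le> 2 * sqrt (vec_energy u)"
proof -
  have "(\<Sum>j<3. u j * bary j x) - u 0 = (u 1 - u 0) * cx x + (u 2 - u 0) * cy x"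
    by (simp add: sum_less_3 bary_def algebra_simps)
  moreover have "\<bar>(u 1 - u 0) * cx x\<bar> \<le> sqrt (vec_energy u) * 1" "\<bar>(u 2 - u 0) * cy x\<bar> \<le> sqrt (vec_energy u) * 1"
    unfolding abs_mult using assms
    by (intro mult_mono abs_diff_le_sqrt_vec_energy; auto simp: closed_tri_def)+
  ultimately show ?thesis by linarith
qed

lemma pl_approx_comb_Suc:
  assumes "n < d" "y \<in> SG k"
  shows "(\<Sum>j<3. u j * pl_approx (Suc m) j (F k n y)) = (\<Sum>i<3. cell_values n u i * pl_approx m i y)"
  using assms by (simp add: pl_approx_Suc cell_values_eq sum_less_3 algebra_simps del: pl_approx.simps)

text \<open>On a cell the difference is that of one level less, for the boundary data
  \<open>cell_values n u\<close>, whose energy is smaller by \<open>theta\<close>; hence the ratio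
  \<open>sqrt theta\<close>. The 6 collects three contributions of at most
  \<open>2 * sqrt (vec_energy u)\<close>: the oscillations of the new and the old approximant and
  the change of a vertex value.\<close>

lemma pl_approx_step_bound:
  "x \<in> SG k \<Longrightarrow> \<bar>(\<Sum>j<3. u j * pl_approx (Suc m) j x) - (\<Sum>j<3. u j * pl_approx m j x)\<bar>
     \<le> 6 * sqrt (vec_energy u) * sqrt theta ^ m"
proof (induction m arbitrary: u x)
  case 0
  then obtain n y where n: "n < d" "y \<in> SG k" "x = F k n y" using SG_F_cases by blast
  have T: "x \<in> closed_tri" "y \<in> closed_tri" using SG_subset_closed_tri 0 n by auto
  have "theta * vec_energy u \<le> 1 * vec_energy u" using theta by (intro mult_right_mono) auto
  then have "sqrt (vec_energy (cell_values n u)) \<le> sqrt (vec_energy u)"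
    using vec_energy_cell_values_theta[OF n(1), of u] by simp
  then have 1: "\<bar>(\<Sum>j<3. u j * pl_approx (Suc 0) j x) - cell_values n u 0\<bar> \<le> 2 * sqrt (vec_energy u)"
    using bary_osc[OF T(2), of "cell_values n u"] pl_approx_comb_Suc[OF n(1,2), of u 0] n(3)
    by (simp del: pl_approx.simps(2) real_sqrt_le_iff)
  have 2: "\<bar>(\<Sum>j<3. u j * pl_approx 0 j x) - u 0\<bar> \<le> 2 * sqrt (vec_energy u)"
    using bary_osc[OF T(1), of u] by simp
  have "\<bar>(u 1 - u 0) * H 1 (F k n (q 0))\<bar> \<le> sqrt (vec_energy u) * 1"
    "\<bar>(u 2 - u 0) * H 2 (F k n (q 0))\<bar> \<le> sqrt (vec_energy u) * 1"
    unfolding abs_mult by (intro mult_mono abs_diff_le_sqrt_vec_energy; simp add: H_nonneg H_le_1)+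
  then have 3: "\<bar>cell_values n u 0 - u 0\<bar> \<le> 2 * sqrt (vec_energy u)"
    using cell_values_diff[OF n(1), of 0 u "u 0"] by (simp add: sum_less_3)
  show ?case using 1 2 3 by (simp del: pl_approx.simps)
next
  case (Suc m)
  then obtain n y where n: "n < d" "y \<in> SG k" "x = F k n y" using SG_F_cases by blast
  have "\<bar>(\<Sum>j<3. u j * pl_approx (Suc (Suc m)) j x) - (\<Sum>j<3. u j * pl_approx (Suc m) j x)\<bar>
      \<le> 6 * sqrt (vec_energy (cell_values n u)) * sqrt theta ^ m"
    unfolding n(3) pl_approx_comb_Suc[OF n(1,2)] by (rule Suc.IH[OF n(2)])
  also have "\<dots> \<le> 6 * sqrt (theta * vec_energy u) * sqrt theta ^ m"
    using vec_energy_cell_values_theta[OF n(1)] theta by (intro mult_right_mono mult_left_mono) auto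
  finally show ?case by (simp add: real_sqrt_mult mult_ac)
qed

definition harm_fun :: "nat \<Rightarrow> complex \<Rightarrow> real" where
  "harm_fun j x = lim (\<lambda>m. pl_approx m j x)"

lemma uniform_limit_pl_approx:
  assumes "j < 3" shows "uniform_limit (SG k) (\<lambda>m. pl_approx m j) (harm_fun j) sequentially"
proof -
  define g where "g m x = pl_approx (Suc m) j x - pl_approx m j x" for m x
  have "norm (g m x) \<le> 6 * sqrt 2 * sqrt theta ^ m" if "x \<in> SG k" for m x
    using pl_approx_step_bound[OF that, of "unit_vec j" m] assms
    by (simp add: sum_unit_vec vec_energy_unit_vec g_def del: pl_approx.simps)
  moreover have "summable (\<lambda>m. 6 * sqrt 2 * sqrt theta ^ m)"
    using theta by (intro summable_mult summable_geometric) auto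
  ultimately have "uniform_limit (SG k) (\<lambda>n x. \<Sum>i<n. g i x) (\<lambda>x. suminf (\<lambda>i. g i x)) sequentially"
    by (rule Weierstrass_m_test)
  then have "uniform_limit (SG k) (\<lambda>n x. pl_approx 0 j x + (\<Sum>i<n. g i x))
      (\<lambda>x. pl_approx 0 j x + suminf (\<lambda>i. g i x)) sequentially"
    by (intro uniform_limit_intros)
  moreover have "pl_approx 0 j x + (\<Sum>i<n. g i x) = pl_approx n j x" for n x
    by (simp add: g_def sum_lessThan_telescope[of "\<lambda>i. pl_approx i j x"] del: pl_approx.simps)
  ultimately have ul: "uniform_limit (SG k) (\<lambda>n. pl_approx n j) (\<lambda>x. pl_approx 0 j x + suminf (\<lambda>i. g i x)) sequentially"
    by simp
  moreover have "pl_approx 0 j x + suminf (\<lambda>i. g i x) = harm_fun j x" if "x \<in> SG k" for x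
    using tendsto_uniform_limitI[OF ul that] unfolding harm_fun_def by (metis limI)
  ultimately show ?thesis
    by (subst uniform_limit_cong'[where g = "\<lambda>n. pl_approx n j" and i = "\<lambda>x. pl_approx 0 j x + suminf (\<lambda>i. g i x)"]) auto
qed

lemma pl_approx_LIMSEQ: "j < 3 \<Longrightarrow> x \<in> SG k \<Longrightarrow> (\<lambda>m. pl_approx m j x) \<longlonglongrightarrow> harm_fun j x"
  by (rule tendsto_uniform_limitI[OF uniform_limit_pl_approx])

lemma continuous_on_harm_fun: "j < 3 \<Longrightarrow> continuous_on (SG k) (harm_fun j)"
  by (rule uniform_limit_theorem[OF _ uniform_limit_pl_approx]) (auto simp: continuous_on_pl_approx)

lemma harm_fun_q: "i < 3 \<Longrightarrow> j < 3 \<Longrightarrow> harm_fun j (q i) = unit_vec j i"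
  by (simp add: harm_fun_def pl_approx_q)

lemma harm_fun_F:
  assumes "n < d" "y \<in> SG k" "j < 3"
  shows "harm_fun j (F k n y) = (\<Sum>i<3. H j (F k n (q i)) * harm_fun i y)"
proof (rule LIMSEQ_unique)
  show "(\<lambda>m. pl_approx (Suc m) j (F k n y)) \<longlonglongrightarrow> harm_fun j (F k n y)"
    by (rule LIMSEQ_Suc[OF pl_approx_LIMSEQ]) (use assms F_in_SG in auto)
  show "(\<lambda>m. pl_approx (Suc m) j (F k n y)) \<longlonglongrightarrow> (\<Sum>i<3. H j (F k n (q i)) * harm_fun i y)"
    unfolding pl_approx_Suc[OF assms(1,2)]
    by (intro tendsto_intros pl_approx_LIMSEQ) (use assms in auto)
qed

section \<open>Values and energies of harmonic functions on all cells\<close>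

primrec word_values :: "nat list \<Rightarrow> (nat \<Rightarrow> real) \<Rightarrow> nat \<Rightarrow> real" where
  "word_values [] u = u"
| "word_values (n # w) u = word_values w (cell_values n u)"

lemma word_values_append: "word_values (v @ w) u = word_values w (word_values v u)"
  by (induction v arbitrary: u) auto

definition harm_comb :: "(nat \<Rightarrow> real) \<Rightarrow> complex \<Rightarrow> real" where
  "harm_comb u x = (\<Sum>j<3. u j * harm_fun j x)"

lemma harm_comb_unit_vec: "i < 3 \<Longrightarrow> harm_comb (unit_vec i) x = harm_fun i x"
  by (simp add: harm_comb_def sum_unit_vec)

lemma harm_comb_q: "i < 3 \<Longrightarrow> harm_comb u (q i) = u i"
  by (simp add: harm_comb_def harm_fun_q sum_unit_vec)

lemma harm_comb_F: "n < d \<Longrightarrow> y \<in> SG k \<Longrightarrow> harm_comb u (F k n y) = harm_comb (cell_values n u) y"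
  by (simp add: harm_comb_def harm_fun_F cell_values_eq sum_less_3 algebra_simps)

lemma harm_comb_Fw: "w \<in> words k m \<Longrightarrow> y \<in> SG k \<Longrightarrow> harm_comb u (Fw k w y) = harm_comb (word_values w u) y"
proof (induction w arbitrary: m u)
  case (Cons n w)
  then obtain m' where m: "m = Suc m'" "w \<in> words k m'" "n < d"
    by (cases m) (auto simp: Cons_in_words words_def)
  then show ?case using Cons Fw_in_SG[OF m(2)] by (simp add: harm_comb_F)
qed simp

lemma harm_comb_Fw_q: "w \<in> words k m \<Longrightarrow> i < 3 \<Longrightarrow> harm_comb u (Fw k w (q i)) = word_values w u i"
  by (simp add: harm_comb_Fw harm_comb_q)

lemma sum_vec_energy_word_values: "(\<Sum>w\<in>words k m. vec_energy (word_values w u)) = renorm ^ m * vec_energy u"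
proof (induction m arbitrary: u)
  case (Suc m)
  then show ?case
    by (simp add: sum_words_Cons sum_vec_energy_cell_values mult.assoc flip: sum_distrib_left)
qed simp

lemma word_values_const: "w \<in> words k m \<Longrightarrow> i < 3 \<Longrightarrow> word_values w (\<lambda>_. c) i = c"
proof (induction w arbitrary: m)
  case (Cons n w)
  then obtain m' where m: "w \<in> words k m'" "n < d"
    by (cases m) (auto simp: Cons_in_words words_def)
  have cell_values: "cell_values n (\<lambda>_. c) j = c" if "j < 3" for j
    using cell_values_diff[OF m(2) that, of "\<lambda>_. c" c] by simp
  have "word_values w (cell_values n (\<lambda>_. c)) i = word_values w (\<lambda>_. c) i"
  \<comment> \<open>The two argument functions are known to agree only at indices below 3. These are
    the only ones read by a further letter, and for the empty word the index \<open>i\<close> is one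
    of them.\<close>
  proof (cases w)
    case (Cons n' w')
    have "cell_values n' (cell_values n (\<lambda>_. c)) = cell_values n' (\<lambda>_. c)" by (intro cell_values_cong cell_values)
    then show ?thesis using Cons by simp
  qed (simp add: cell_values Cons.prems)
  then show ?case using Cons.IH[OF m(1) Cons.prems(2)] by simp
qed simp

lemma word_values_expand:
  "w \<in> words k m \<Longrightarrow> l < 3 \<Longrightarrow> word_values w u l = (\<Sum>i<3. u i * word_values w (unit_vec i) l)"
  by (simp add: harm_comb_unit_vec flip: harm_comb_Fw_q) (simp add: harm_comb_def)

lemma Em_SG:
  assumes "\<And>x. x \<in> SG k \<Longrightarrow> g x = harm_comb u x"
  shows "Em k renorm m g = vec_energy u"
proof -
  have "tri_energy (g \<circ> Fw k w) = vec_energy (word_values w u)" if "w \<in> words k m" for w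
    unfolding tri_energy_eq_vec_energy using that assms by (intro vec_energy_cong) (simp add: Fw_in_SG harm_comb_Fw_q)
  then show ?thesis
    using renorm_pos by (simp add: Em_eq sum_vec_energy_word_values power_int_minus)
qed

text \<open>Equal energies on levels \<open>m\<close> and \<open>m + 1\<close> mean equality in a
  sum of the cellwise inequalities \<open>energy1_ge\<close>. Equality then holds in every cell,
  which forces the minimising extension there.\<close>

lemma harmonic_sg_values:
  assumes "harmonic_sg k h"
  shows "w \<in> words k m \<Longrightarrow> i < 3 \<Longrightarrow> h (Fw k w (q i)) = word_values w (\<lambda>i. h (q i)) i"
proof (induction m arbitrary: w i)
  case (Suc m)
  obtain v n where w: "w = v @ [n]" "v \<in> words k m" "n < d"
    using Suc.prems unfolding words_Suc_snoc by auto
  have Em: "(\<Sum>w\<in>words k m. tri_energy (h \<circ> Fw k w)) = renorm ^ m * tri_energy h" for m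
    using assms[unfolded harmonic_sg_def rk_eq, rule_format, of m] renorm_pos
    by (simp add: Em_0) (simp add: Em_eq power_int_minus field_simps)
  have "(\<Sum>w\<in>words k m. energy1 (h \<circ> Fw k w) - renorm * tri_energy (h \<circ> Fw k w)) = 0"
    using Em[of "Suc m"] Em[of m]
    by (simp add: sum_words_snoc sum_subtractf energy1_def Fw_append comp_assoc comp_def flip: sum_distrib_left)
  then have "\<forall>w\<in>words k m. energy1 (h \<circ> Fw k w) - renorm * tri_energy (h \<circ> Fw k w) = 0"
    by (subst (asm) sum_nonneg_eq_0_iff) (auto simp: energy1_ge)
  then have "energy1 (h \<circ> Fw k v) = renorm * tri_energy (h \<circ> Fw k v)" using w(2) by simp
  from energy1_eq_imp_harm_ext[OF this w(3) Suc.prems(2)]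
  have "h (Fw k w (q i)) = cell_values n (\<lambda>i. h (Fw k v (q i))) i"
    by (simp add: w Fw_append cell_values_def)
  also have "\<dots> = cell_values n (word_values v (\<lambda>i. h (q i))) i"
    by (simp add: cell_values_cong[of "\<lambda>i. h (Fw k v (q i))" "word_values v (\<lambda>i. h (q i))"] Suc.IH[OF w(2)])
  finally show ?case by (simp add: w word_values_append)
qed simp

lemma hb_eq:
  assumes i: "i < 3"
  shows "hb k i = restrict (harm_fun i) (SG k)"
  unfolding hb_def
proof (rule the_equality, intro conjI)
  let ?g = "restrict (harm_fun i) (SG k)"
  show "?g \<in> extensional (SG k)" by simp
  show "continuous_on (SG k) ?g"
    using continuous_on_harm_fun[OF i] by (simp cong: continuous_on_cong)
  have "Em k renorm m ?g = vec_energy (unit_vec i)" for m by (rule Em_SG) (simp add: harm_comb_unit_vec i)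
  then show "harmonic_sg k ?g" by (simp add: harmonic_sg_def rk_eq)
  show "\<forall>j<3. ?g (q j) = (if i = j then 1 else 0)" using i by (auto simp: harm_fun_q unit_vec_def)
next
  fix h assume h: "h \<in> extensional (SG k) \<and> continuous_on (SG k) h \<and> harmonic_sg k h \<and>
      (\<forall>j<3. h (q j) = (if i = j then 1 else 0))"
  have eq: "h (Fw k w (q 0)) = harm_fun i (Fw k w (q 0))" if w: "w \<in> words k m" for w m
  proof -
    have "h (Fw k w (q 0)) = word_values w (\<lambda>j. h (q j)) 0"
      using harmonic_sg_values h w by auto
    also have "\<dots> = harm_comb (\<lambda>j. h (q j)) (Fw k w (q 0))" using w by (simp add: harm_comb_Fw_q)
    also have "\<dots> = harm_comb (unit_vec i) (Fw k w (q 0))"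
      unfolding harm_comb_def using h by (intro sum.cong) (auto simp: unit_vec_def)
    finally show ?thesis by (simp add: harm_comb_unit_vec i)
  qed
  \<comment> \<open>The images of \<open>q 0\<close> under all words are dense, so continuity
    extends the agreement to the whole gasket.\<close>
  have "h x = harm_fun i x" if x: "x \<in> SG k" for x
  proof -
    have "\<exists>w y. w \<in> words k m \<and> y \<in> SG k \<and> x = Fw k w y" for m
      using x SG_Fw_cases by metis
    then obtain W Y where W: "\<And>m. W m \<in> words k m" "\<And>m. Y m \<in> SG k" "\<And>m. x = Fw k (W m) (Y m)"
      by metis
    define X where "X m = Fw k (W m) (q 0)" for m
    have XSG: "X m \<in> SG k" for m using Fw_in_SG[OF W(1)] unfolding X_def by auto
    have "(\<lambda>m. dist (X m) x) \<longlonglongrightarrow> 0"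
    proof (rule tendsto_sandwich[OF _ _ tendsto_const])
      have "(\<lambda>m. 4 * (1 / real k) ^ m) \<longlonglongrightarrow> 4 * 0"
        using k_ge2 by (intro tendsto_mult tendsto_const LIMSEQ_power_zero) auto
      then show "(\<lambda>m. 4 / real k ^ m) \<longlonglongrightarrow> 0" by (simp add: power_one_over)
      show "\<forall>\<^sub>F m in sequentially. dist (X m) x \<le> 4 / real k ^ m"
      proof (intro always_eventually allI)
        fix m show "dist (X m) x \<le> 4 / real k ^ m"
          using W(2) by (intro dist_in_cell[OF W(1)]) (auto simp: X_def W(3)[of m, symmetric], metis W(3) imageI)
      qed
    qed auto
    then have "X \<longlonglongrightarrow> x" by (rule tendsto_dist_iff[THEN iffD2])
    then have "(\<lambda>m. h (X m)) \<longlonglongrightarrow> h x" "(\<lambda>m. harm_fun i (X m)) \<longlonglongrightarrow> harm_fun i x"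
      using h continuous_on_harm_fun[OF i] XSG x
      by (auto intro: continuous_on_tendsto_compose)
    moreover have "h (X m) = harm_fun i (X m)" for m unfolding X_def using eq W(1) .
    ultimately show ?thesis using LIMSEQ_unique[of "\<lambda>m. harm_fun i (X m)"] by simp
  qed
  then show "h = restrict (harm_fun i) (SG k)" using h by (auto simp: extensional_def fun_eq_iff)
qed

lemma p_eq: "j < 3 \<Longrightarrow> n < d \<Longrightarrow> i < 3 \<Longrightarrow> p k j n i = cell_values n (unit_vec j) i"
  by (simp add: p_def hb_eq F_in_SG harm_fun_F harm_fun_q sum_unit_vec cell_values_eq mult.commute)

subsection \<open>Cell masses\<close>

definition mass :: "(nat \<Rightarrow> real) \<Rightarrow> nat list \<Rightarrow> real" where
  "mass u w = vec_energy (word_values w u) / renorm ^ length w"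

lemma mass_nonneg [simp]: "0 \<le> mass u w"
  using renorm_pos by (simp add: mass_def)

text \<open>On the gasket \<open>hb k i \<circ> Fw k w\<close> is again a harmonic combination, so
  the sequence whose limit defines its energy is constant.\<close>

lemma energy_hb_cell:
  assumes "i < 3" "w \<in> words k m"
  shows "rk k powi (- int m) * energy k (hb k i \<circ> Fw k w) = mass (unit_vec i) w"
proof -
  have "length w = m" using assms by (simp add: words_def)
  moreover have "Em k renorm m' (hb k i \<circ> Fw k w) = vec_energy (word_values w (unit_vec i))" for m'
    by (rule Em_SG) (use assms Fw_in_SG in \<open>simp add: hb_eq flip: harm_comb_Fw harm_comb_unit_vec\<close>)
  then have "energy k (hb k i \<circ> Fw k w) = vec_energy (word_values w (unit_vec i))"
    by (simp add: energy_def rk_eq)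
  ultimately show ?thesis by (simp add: rk_eq mass_def power_int_minus field_simps)
qed

lemma mass_split: "mass u w = (\<Sum>n<d. mass u (w @ [n]))"
  using renorm_pos by (simp add: mass_def word_values_append sum_vec_energy_cell_values flip: sum_divide_distrib)

lemma mass_snoc_le: "n < d \<Longrightarrow> mass u (w @ [n]) \<le> theta * mass u w"
  using vec_energy_cell_values_le[of n "word_values w u"] renorm_pos
  by (simp add: mass_def word_values_append theta_def divide_simps mult_ac)

lemma mass_decay: "w \<in> words k m \<Longrightarrow> mass u w \<le> theta ^ m * vec_energy u"
proof (induction m arbitrary: w)
  case (Suc m)
  obtain v n where w: "w = v @ [n]" "v \<in> words k m" "n < d"
    using Suc.prems unfolding words_Suc_snoc by auto
  have "mass u w \<le> theta * mass u v" unfolding w using w(3) by (rule mass_snoc_le)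
  also have "\<dots> \<le> theta * (theta ^ m * vec_energy u)"
    using Suc.IH[OF w(2)] theta by (intro mult_left_mono) auto
  finally show ?case by (simp add: mult.assoc)
qed (simp add: mass_def)

lemma mass_Cons:
  assumes n: "n < d" and w: "w \<in> words k m" and j: "j < 3"
  shows "mass (unit_vec j) (n # w) = (\<Sum>i<3. mu k n j i * mass (unit_vec i) w)"
proof -
  define a where "a = cell_values n (unit_vec j)"
  define P where "P i = word_values w (unit_vec i)" for i
  have one: "P 0 l + P 1 l + P 2 l = 1" if "l < 3" for l
    using word_values_expand[OF w that, of "\<lambda>_. 1"] word_values_const[OF w that, of 1]
    by (simp add: sum_less_3 P_def)
  have "vec_energy (word_values w a) = vec_energy (\<lambda>l. \<Sum>i<3. a i * P i l)"
    unfolding P_def using word_values_expand[OF w] by (intro vec_energy_cong) auto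
  \<comment> \<open>Eliminating \<open>P 0\<close> through \<open>P 0 + P 1 + P 2 = 1\<close> turns
    the polarisation formula into a polynomial identity.\<close>
  also have "\<dots> = vec_energy (\<lambda>l. a 0 * (1 - P 1 l - P 2 l) + a 1 * P 1 l + a 2 * P 2 l)"
    using one by (intro vec_energy_cong) (simp add: sum_less_3, metis add_diff_cancel_right' diff_diff_add add.assoc)
  also have "\<dots> = ((a 0)\<^sup>2 - a 0 * a 1 - a 0 * a 2 + a 1 * a 2) * vec_energy (\<lambda>l. 1 - P 1 l - P 2 l)
      + ((a 1)\<^sup>2 - a 0 * a 1 + a 0 * a 2 - a 1 * a 2) * vec_energy (P 1)
      + ((a 2)\<^sup>2 + a 0 * a 1 - a 0 * a 2 - a 1 * a 2) * vec_energy (P 2)"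
    unfolding vec_energy_def by algebra
  also have "vec_energy (\<lambda>l. 1 - P 1 l - P 2 l) = vec_energy (P 0)"
    using one by (intro vec_energy_cong) (smt (verit))
  finally have vec_energy: "vec_energy (word_values w a) = ((a 0)\<^sup>2 - a 0 * a 1 - a 0 * a 2 + a 1 * a 2) * vec_energy (P 0)
      + ((a 1)\<^sup>2 - a 0 * a 1 + a 0 * a 2 - a 1 * a 2) * vec_energy (P 1)
      + ((a 2)\<^sup>2 + a 0 * a 1 - a 0 * a 2 - a 1 * a 2) * vec_energy (P 2)" .
  have "p k j n i = a i" if "i < 3" for i using p_eq[OF j n that] by (simp add: a_def)
  then have "(\<Sum>i<3. mu k n j i * mass (unit_vec i) w) = vec_energy (word_values w a) / renorm / renorm ^ length w"
    unfolding vec_energy mu_def Let_def rk_eq mass_def P_def [symmetric]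
    by (simp add: sum_less_3 add_divide_distrib mult_ac)
  then show ?thesis by (simp add: mass_def a_def)
qed

end

subsection \<open>Cell measures\<close>

definition borel_additive :: "('a::topological_space set \<Rightarrow> real) \<Rightarrow> bool" where
  "borel_additive f \<longleftrightarrow> (\<forall>A. range A \<subseteq> sets borel \<longrightarrow> disjoint_family A \<longrightarrow> (\<lambda>i::nat. f (A i)) sums f (\<Union>i. A i))"

lemma borel_additive_empty: "borel_additive f \<Longrightarrow> f {} = 0"
proof -
  assume "borel_additive f"
  then have "(\<lambda>i::nat. f {}) sums f {}"
    unfolding borel_additive_def by (elim allE[of _ "\<lambda>_. {}"]) (auto simp: disjoint_family_on_def)
  then show ?thesis using summable_const_iff sums_summable by blast
qed

lemma borel_additive_Compl:
  assumes "borel_additive f" "B \<in> sets borel" shows "f (- B) = f UNIV - f B"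
proof -
  have "disjoint_family (binaryset B (- B))"
    by (auto simp: disjoint_family_on_def binaryset_def)
  moreover have "range (binaryset B (- B)) \<subseteq> sets borel"
    using assms(2) by (simp add: range_binaryset_eq borel_comp)
  ultimately have "(\<lambda>i. f (binaryset B (- B) i)) sums f (\<Union>i. binaryset B (- B) i)"
    using assms(1) unfolding borel_additive_def by blast
  then have "(\<lambda>i. f (binaryset B (- B) i)) sums f (B \<union> - B)"
    unfolding UN_binaryset_eq .
  moreover have "(\<lambda>i. f (binaryset B (- B) i)) sums (f B + f (- B))"
    by (rule binaryset_sums) (rule borel_additive_empty[OF assms(1)])
  ultimately have "f (B \<union> - B) = f B + f (- B)" by (rule sums_unique2)
  then show ?thesis by simp
qed

text \<open>Dynkin's argument over the closed sets, an intersection-stable generator of the Borel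
  sets; equality on \<open>UNIV\<close> handles complements.\<close>

lemma borel_additive_eqI:
  assumes f: "borel_additive f" and g: "borel_additive g" and closed: "\<And>C. closed C \<Longrightarrow> f C = g C"
    and B: "B \<in> sets borel"
  shows "f B = g B"
proof -
  have sets: "sets (borel :: 'a measure) = sigma_sets UNIV (Collect closed)"
    by (simp add: borel_eq_closed)
  have "Int_stable (Collect closed :: 'a set set)" by (auto simp: Int_stable_def)
  moreover have "Collect closed \<subseteq> Pow (UNIV :: 'a set)" by simp
  moreover have "B \<in> sigma_sets UNIV (Collect closed)" using B sets by simp
  ultimately show ?thesis
  proof (induction B rule: sigma_sets_induct_disjoint)
    case (compl B)
    then show ?case
      using borel_additive_Compl[OF f] borel_additive_Compl[OF g] closed[of UNIV] by (simp add: Compl_eq_Diff_UNIV sets)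
  next
    case (union A)
    then have "range A \<subseteq> sets borel" by (simp add: sets)
    then have "(\<lambda>i. f (A i)) sums f (\<Union>i. A i)" "(\<lambda>i. g (A i)) sums g (\<Union>i. A i)"
      using f g union unfolding borel_additive_def by blast+
    moreover have "(\<lambda>i. f (A i)) = (\<lambda>i. g (A i))" using union by auto
    ultimately show ?case using sums_unique2[of "\<lambda>i. f (A i)"] by simp
  qed (use closed in auto)
qed

lemma borel_additive_cmult: "borel_additive f \<Longrightarrow> borel_additive (\<lambda>B. c * f B)"
  unfolding borel_additive_def by (auto intro: sums_mult)

lemma borel_additive_sum: "(\<And>i. i \<in> I \<Longrightarrow> borel_additive (f i)) \<Longrightarrow> borel_additive (\<lambda>B. \<Sum>i\<in>I. f i B)"
  unfolding borel_additive_def by (auto intro!: sums_sum)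

context sierpinski
begin

definition cell_measure :: "(nat \<Rightarrow> real) \<Rightarrow> complex measure \<Rightarrow> bool" where
  "cell_measure u \<nu> \<longleftrightarrow> sets \<nu> = sets (restrict_space borel (SG k)) \<and>
     (\<forall>m. \<forall>w\<in>words k m. emeasure \<nu> (Fw k w ` SG k) = ennreal (mass u w))"

lemma closed_SG: "closed (SG k)"
  by (simp add: SG_compact compact_imp_closed)

lemma closed_cell: "closed (Fw k w ` SG k)"
  by (intro compact_imp_closed compact_continuous_image continuous_on_Fw SG_compact)

lemma SG_sets_iff: "A \<in> sets (restrict_space borel (SG k)) \<longleftrightarrow> A \<subseteq> SG k \<and> A \<in> sets borel"
  using closed_SG by (subst sets_restrict_space_iff) auto

lemma cell_sets: "w \<in> words k m \<Longrightarrow> Fw k w ` SG k \<in> sets (restrict_space borel (SG k))"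
  using closed_cell Fw_in_SG by (auto simp: SG_sets_iff)

lemma cell_measure_space: "cell_measure u \<nu> \<Longrightarrow> space \<nu> = SG k"
  unfolding cell_measure_def by (metis sets_eq_imp_space_eq space_restrict_space2 space_borel Int_UNIV_right space_restrict_space)

lemma cell_measure_finite: "cell_measure u \<nu> \<Longrightarrow> finite_measure \<nu>"
proof
  assume \<nu>: "cell_measure u \<nu>"
  then have "emeasure \<nu> (Fw k [] ` SG k) = ennreal (mass u [])"
    unfolding cell_measure_def by (metis words_0 singletonI)
  then show "emeasure \<nu> (space \<nu>) \<noteq> \<infinity>" by (simp add: cell_measure_space[OF \<nu>])
qed

lemma cell_measure_cell:
  "cell_measure u \<nu> \<Longrightarrow> w \<in> words k m \<Longrightarrow> measure \<nu> (Fw k w ` SG k) = mass u w"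
  unfolding cell_measure_def measure_def by simp

lemma sum_mass: "(\<Sum>w\<in>words k m. mass u w) = vec_energy u"
proof -
  have "(\<Sum>w\<in>words k m. mass u w) = (\<Sum>w\<in>words k m. vec_energy (word_values w u)) / renorm ^ m"
    unfolding sum_divide_distrib by (intro sum.cong) (auto simp: mass_def words_def)
  then show ?thesis using renorm_pos by (simp add: sum_vec_energy_word_values)
qed

text \<open>Subadditivity bounds the measure of the union over \<open>W\<close> and over its
  complement by the respective masses. These add up to the total mass, so no bound can be strict;
  overlaps are thus null.\<close>

lemma cell_measure_union:
  assumes \<nu>: "cell_measure u \<nu>" and W: "W \<subseteq> words k m"
  shows "measure \<nu> (\<Union>w\<in>W. Fw k w ` SG k) = (\<Sum>w\<in>W. mass u w)"
proof -
  interpret finite_measure \<nu> using cell_measure_finite[OF \<nu>] .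
  have sets: "Fw k w ` SG k \<in> sets \<nu>" if "w \<in> words k m" for w
    using \<nu> cell_sets that unfolding cell_measure_def by blast
  define U where "U V = (\<Union>w\<in>V. Fw k w ` SG k)" for V
  have U: "U V \<in> sets \<nu>" if "V \<subseteq> words k m" for V
    unfolding U_def using sets that finite_subset[OF that] by (intro sets.finite_UN) auto
  have le: "measure \<nu> (U V) \<le> (\<Sum>w\<in>V. mass u w)" if V: "V \<subseteq> words k m" for V
  proof -
    have "measure \<nu> (U V) \<le> (\<Sum>w\<in>V. measure \<nu> (Fw k w ` SG k))"
      unfolding U_def using sets V finite_subset[OF V] by (intro finite_measure_subadditive_finite) auto
    also have "\<dots> = (\<Sum>w\<in>V. mass u w)"
      using V cell_measure_cell[OF \<nu>] by (intro sum.cong) auto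
    finally show ?thesis .
  qed
  have "U W \<union> U (words k m - W) = SG k"
  proof -
    have "U W \<union> U (words k m - W) = U (W \<union> (words k m - W))" by (simp only: U_def UN_Un)
    also have "W \<union> (words k m - W) = words k m" using W by blast
    finally show ?thesis using SG_words[of m] by (simp add: U_def)
  qed
  then have "vec_energy u \<le> measure \<nu> (U W) + measure \<nu> (U (words k m - W))"
    using cell_measure_cell[OF \<nu>, of "[]" 0] measure_Un_le[OF U[OF W] U[of "words k m - W"]]
    by (simp add: mass_def)
  also have "measure \<nu> (U (words k m - W)) \<le> (\<Sum>w\<in>words k m - W. mass u w)" by (rule le) auto
  also have "(\<Sum>w\<in>words k m - W. mass u w) = vec_energy u - (\<Sum>w\<in>W. mass u w)"
    using W by (simp add: sum_diff sum_mass)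
  finally show ?thesis using le[OF W] by (simp add: U_def)
qed

definition hit :: "nat \<Rightarrow> complex set \<Rightarrow> nat list set" where
  "hit m A = {w \<in> words k m. Fw k w ` SG k \<inter> A \<noteq> {}}"

text \<open>A closed set is the decreasing intersection of the unions of the cells that meet it.\<close>
lemma cell_measure_closed_LIMSEQ:
  assumes \<nu>: "cell_measure u \<nu>" and A: "closed A" "A \<subseteq> SG k"
  shows "(\<lambda>m. \<Sum>w\<in>hit m A. mass u w) \<longlonglongrightarrow> measure \<nu> A"
proof -
  interpret finite_measure \<nu> using cell_measure_finite[OF \<nu>] .
  define U where "U m = (\<Union>w\<in>hit m A. Fw k w ` SG k)" for m
  have hit: "hit m A \<subseteq> words k m" for m by (auto simp: hit_def)
  have sets: "range U \<subseteq> sets \<nu>"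
  proof -
    have "U m \<in> sets \<nu>" for m
      unfolding U_def using \<nu> cell_sets hit finite_subset[OF hit finite_words]
      by (intro sets.finite_UN) (auto simp: cell_measure_def)
    then show ?thesis by auto
  qed
  have dec: "decseq U"
  proof (rule decseq_SucI, rule subsetI)
    fix m x assume "x \<in> U (Suc m)"
    then obtain w n where w: "w \<in> words k m" "n < d" "x \<in> Fw k (w @ [n]) ` SG k"
      "Fw k (w @ [n]) ` SG k \<inter> A \<noteq> {}"
      by (auto simp: U_def hit_def words_Suc_snoc)
    have "Fw k (w @ [n]) ` SG k \<subseteq> Fw k w ` SG k"
      using F_in_SG[OF w(2)] by (auto simp: Fw_snoc)
    then have "x \<in> Fw k w ` SG k" "Fw k w ` SG k \<inter> A \<noteq> {}" using w(3,4) by blast+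
    then show "x \<in> U m" using w(1) by (auto simp: U_def hit_def)
  qed
  have "(\<Inter>m. U m) = A"
  proof (intro equalityI subsetI)
    fix x assume x: "x \<in> (\<Inter>m. U m)"
    have "\<exists>y\<in>A. dist y x < e" if e: "0 < e" for e
    proof -
      obtain m where m: "4 / real k ^ m < e" using geometric_k_small[OF e] by blast
      have "x \<in> U m" using x by blast
      then obtain w y where w: "w \<in> words k m" "x \<in> Fw k w ` SG k" "y \<in> Fw k w ` SG k" "y \<in> A"
        by (auto simp: U_def hit_def)
      then have "dist y x < e" using dist_in_cell[OF w(1,3,2)] m by simp
      then show ?thesis using w(4) by blast
    qed
    then have "x \<in> closure A" by (simp add: closure_approachable)
    then show "x \<in> A" using A(1) by simp
  next
    fix x assume x: "x \<in> A"
    show "x \<in> (\<Inter>m. U m)"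
    proof
      fix m
      obtain w y where "w \<in> words k m" "y \<in> SG k" "x = Fw k w y"
        using SG_Fw_cases x A(2) by blast
      then show "x \<in> U m" using x by (auto simp: U_def hit_def)
    qed
  qed
  moreover have "measure \<nu> (U m) = (\<Sum>w\<in>hit m A. mass u w)" for m
    unfolding U_def using cell_measure_union[OF \<nu> hit] .
  ultimately show ?thesis using finite_Lim_measure_decseq[OF sets dec] by simp
qed

lemma vimage_sets:
  fixes T :: "complex \<Rightarrow> complex"
  assumes "cell_measure u \<nu>" "continuous_on UNIV T" "B \<in> sets borel"
  shows "T -` B \<inter> SG k \<in> sets \<nu>"
proof -
  have "T \<in> borel_measurable borel" using assms(2) by (rule borel_measurable_continuous_onI)
  then have "T -` B \<in> sets borel" using measurable_sets[of T borel borel B] assms(3) by simp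
  then show ?thesis
    using assms(1) closed_SG unfolding cell_measure_def by (auto simp: SG_sets_iff)
qed

text \<open>Stated for a general \<open>T\<close> to cover the measure itself (\<open>T\<close> the
  identity) and its images under the cell maps (\<open>T = F k n\<close>).\<close>

lemma borel_additive_cell_measure:
  fixes T :: "complex \<Rightarrow> complex"
  assumes \<nu>: "cell_measure u \<nu>" and T: "continuous_on UNIV T"
  shows "borel_additive (\<lambda>B. measure \<nu> (T -` B \<inter> SG k))"
  unfolding borel_additive_def
proof (intro allI impI)
  fix A :: "nat \<Rightarrow> complex set" assume A: "range A \<subseteq> sets borel" "disjoint_family A"
  interpret finite_measure \<nu> using cell_measure_finite[OF \<nu>] .
  have "(\<lambda>i. measure \<nu> (T -` A i \<inter> SG k)) sums measure \<nu> (\<Union>i. T -` A i \<inter> SG k)"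
    using A vimage_sets[OF \<nu> T]
    by (intro finite_measure_UNION) (fastforce simp: disjoint_family_on_def)+
  then show "(\<lambda>i. measure \<nu> (T -` A i \<inter> SG k)) sums measure \<nu> (T -` (\<Union>i. A i) \<inter> SG k)"
    by (simp add: vimage_UN)
qed

lemma borel_additive_cell_measure_id: "cell_measure u \<nu> \<Longrightarrow> borel_additive (\<lambda>B. measure \<nu> (B \<inter> SG k))"
  using borel_additive_cell_measure[of u \<nu> "\<lambda>x. x"] by (simp add: vimage_def)

lemma cell_measure_unique:
  assumes \<nu>: "cell_measure u \<nu>" and \<nu>': "cell_measure u \<nu>'"
  shows "\<nu> = \<nu>'"
proof (rule measure_eqI)
  show "sets \<nu> = sets \<nu>'" using assms by (simp add: cell_measure_def)
  fix A assume "A \<in> sets \<nu>"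
  then have A: "A \<subseteq> SG k" "A \<in> sets borel" using \<nu> by (auto simp: cell_measure_def SG_sets_iff)
  interpret N: finite_measure \<nu> using cell_measure_finite[OF \<nu>] .
  interpret N': finite_measure \<nu>' using cell_measure_finite[OF \<nu>'] .
  have "measure \<nu> (A \<inter> SG k) = measure \<nu>' (A \<inter> SG k)"
  proof (rule borel_additive_eqI[OF borel_additive_cell_measure_id[OF \<nu>] borel_additive_cell_measure_id[OF \<nu>'] _ A(2)])
    fix C :: "complex set" assume "closed C"
    then have "closed (C \<inter> SG k)" using closed_SG by auto
    then show "measure \<nu> (C \<inter> SG k) = measure \<nu>' (C \<inter> SG k)"
      using LIMSEQ_unique cell_measure_closed_LIMSEQ[OF \<nu>, of "C \<inter> SG k"]
        cell_measure_closed_LIMSEQ[OF \<nu>', of "C \<inter> SG k"] by blast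
  qed
  then show "emeasure \<nu> A = emeasure \<nu>' A"
    using A(1) by (simp add: N.emeasure_eq_measure N'.emeasure_eq_measure Int_absorb2)
qed

subsection \<open>Existence of the energy measures\<close>

text \<open>Nested subdivision of \<open>[0, vec_energy u)\<close> into intervals of length \<open>mass u w\<close>; a point of the
  interval is sent to the point of the gasket with the same address.\<close>

definition left_end :: "(nat \<Rightarrow> real) \<Rightarrow> nat list \<Rightarrow> real" where
  "left_end u w = (\<Sum>i<length w. \<Sum>n<w ! i. mass u (take i w @ [n]))"

definition ivl :: "(nat \<Rightarrow> real) \<Rightarrow> nat list \<Rightarrow> real set" where
  "ivl u w = {left_end u w ..< left_end u w + mass u w}"

lemma left_end_snoc: "left_end u (w @ [n]) = left_end u w + (\<Sum>n'<n. mass u (w @ [n']))"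
  by (simp add: left_end_def nth_append)

lemma ivl_snoc:
  "t \<in> ivl u (w @ [n]) \<longleftrightarrow> left_end u w + (\<Sum>i<n. mass u (w @ [i])) \<le> t \<and>
     t < left_end u w + (\<Sum>i<Suc n. mass u (w @ [i]))"
  by (simp add: ivl_def left_end_snoc add_ac)

lemma sum_mass_mono: "n \<le> n' \<Longrightarrow> (\<Sum>i<n. mass u (w @ [i])) \<le> (\<Sum>i<n'. mass u (w @ [i]))"
  by (intro sum_mono2) auto

lemma ivl_snoc_subset: "n < d \<Longrightarrow> ivl u (w @ [n]) \<subseteq> ivl u w"
proof
  fix t assume n: "n < d" and t: "t \<in> ivl u (w @ [n])"
  have "(\<Sum>i<Suc n. mass u (w @ [i])) \<le> mass u w"
    unfolding mass_split[of u w] using n by (intro sum_mass_mono) auto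
  moreover have "0 \<le> (\<Sum>i<n. mass u (w @ [i]))" by (intro sum_nonneg) auto
  ultimately show "t \<in> ivl u w" using t unfolding ivl_snoc by (simp add: ivl_def del: sum.lessThan_Suc)
qed

text \<open>Half-open intervals tile the parent exactly, and a subcell of mass 0 receives an empty
  interval. The right child is found as the first one whose right end exceeds
  \<open>t\<close>.\<close>

lemma ivl_snoc_ex1:
  assumes t: "t \<in> ivl u w" shows "\<exists>!n. n < d \<and> t \<in> ivl u (w @ [n])"
proof -
  define s where "s n = left_end u w + (\<Sum>i<n. mass u (w @ [i]))" for n
  have st: "t \<in> ivl u (w @ [n]) \<longleftrightarrow> s n \<le> t \<and> t < s (Suc n)" for n
    unfolding s_def by (rule ivl_snoc)
  have mono: "s n \<le> s n'" if "n \<le> n'" for n n'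
    unfolding s_def using sum_mass_mono that by auto
  have "s 0 \<le> t" "t < s d" using t by (simp_all add: s_def ivl_def flip: mass_split)
  define N where "N = (LEAST n. t < s n)"
  have N: "t < s N" "N \<le> d" unfolding N_def using \<open>t < s d\<close> by (rule LeastI, rule Least_le)
  then obtain n where n: "N = Suc n" using \<open>s 0 \<le> t\<close> by (cases N) auto
  then have "s n \<le> t" using not_less_Least[of n "\<lambda>n. t < s n"] N_def by auto
  then have ex: "n < d \<and> t \<in> ivl u (w @ [n])" using N n st by auto
  show ?thesis
  proof (rule ex1I)
    show "n < d \<and> t \<in> ivl u (w @ [n])" by (rule ex)
    fix n' assume n': "n' < d \<and> t \<in> ivl u (w @ [n'])"
    then have "s n \<le> t" "t < s (Suc n)" "s n' \<le> t" "t < s (Suc n')" using ex st by auto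
    then show "n' = n" using mono[of "Suc n" n'] mono[of "Suc n'" n]
      by (meson dual_order.strict_trans1 linorder_not_le not_less_eq_eq order_antisym)
  qed
qed

lemma ivl_ex1: "t \<in> ivl u [] \<Longrightarrow> \<exists>!w. w \<in> words k m \<and> t \<in> ivl u w"
proof (induction m)
  case (Suc m)
  then obtain w where w: "w \<in> words k m" "t \<in> ivl u w"
    and uw: "\<And>w'. w' \<in> words k m \<Longrightarrow> t \<in> ivl u w' \<Longrightarrow> w' = w" by blast
  obtain n where n: "n < d" "t \<in> ivl u (w @ [n])"
    and un: "\<And>n'. n' < d \<Longrightarrow> t \<in> ivl u (w @ [n']) \<Longrightarrow> n' = n"
    using ivl_snoc_ex1[OF w(2)] by blast
  show ?case
  proof (rule ex1I[of _ "w @ [n]"])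
    show "w @ [n] \<in> words k (Suc m) \<and> t \<in> ivl u (w @ [n])" using w n by (simp add: snoc_in_words)
    fix v assume v: "v \<in> words k (Suc m) \<and> t \<in> ivl u v"
    then obtain w' n' where v': "v = w' @ [n']" "w' \<in> words k m" "n' < d"
      unfolding words_Suc_snoc by auto
    then have "w' = w" using uw v ivl_snoc_subset by blast
    then show "v = w @ [n]" using un v v' by blast
  qed
qed auto

definition addr :: "(nat \<Rightarrow> real) \<Rightarrow> nat \<Rightarrow> real \<Rightarrow> nat list" where
  "addr u m t = (THE w. w \<in> words k m \<and> t \<in> ivl u w)"

lemma addr:
  assumes "t \<in> ivl u []"
  shows addr_words: "addr u m t \<in> words k m" and addr_ivl: "t \<in> ivl u (addr u m t)"
    and addr_eqI: "w \<in> words k m \<Longrightarrow> t \<in> ivl u w \<Longrightarrow> addr u m t = w"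
proof -
  show "addr u m t \<in> words k m" "t \<in> ivl u (addr u m t)"
    using theI'[OF ivl_ex1[OF assms, of m]] by (simp_all add: addr_def)
  show "w \<in> words k m \<Longrightarrow> t \<in> ivl u w \<Longrightarrow> addr u m t = w"
    unfolding addr_def by (rule the1_equality[OF ivl_ex1[OF assms, of m]]) simp
qed

lemma addr_eq_iff: "t \<in> ivl u [] \<Longrightarrow> w \<in> words k m \<Longrightarrow> addr u m t = w \<longleftrightarrow> t \<in> ivl u w"
  using addr_eqI addr_ivl by blast

definition coding :: "(nat \<Rightarrow> real) \<Rightarrow> real \<Rightarrow> complex" where
  "coding u t = lim (\<lambda>m. Fw k (addr u m t) (q 0))"

lemma addr_cell_decseq:
  assumes "t \<in> ivl u []" shows "decseq (\<lambda>m. Fw k (addr u m t) ` SG k)"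
proof (rule decseq_SucI)
  fix m
  obtain w n where w: "addr u (Suc m) t = w @ [n]" "w \<in> words k m" "n < d"
    using addr_words[OF assms, of "Suc m"] unfolding words_Suc_snoc by auto
  then have "addr u m t = w"
    using addr_ivl[OF assms, of "Suc m"] ivl_snoc_subset[OF w(3), of u w] addr_eqI[OF assms w(2)] by auto
  then show "Fw k (addr u (Suc m) t) ` SG k \<subseteq> Fw k (addr u m t) ` SG k"
    using w F_in_SG by (auto simp: Fw_snoc)
qed

lemma coding_in_cell:
  assumes t: "t \<in> ivl u []" shows "coding u t \<in> Fw k (addr u m t) ` SG k"
proof -
  define X where "X m = Fw k (addr u m t) (q 0)" for m
  have X: "X m' \<in> Fw k (addr u m t) ` SG k" if "m \<le> m'" for m m'
    using decseqD[OF addr_cell_decseq[OF t] that] unfolding X_def by auto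
  have "Cauchy X"
  proof (rule metric_CauchyI)
    fix e :: real assume e: "0 < e"
    obtain M where M: "4 / real k ^ M < e" using geometric_k_small[OF e] by blast
    show "\<exists>M. \<forall>m\<ge>M. \<forall>n\<ge>M. dist (X m) (X n) < e"
      using dist_in_cell[OF addr_words[OF t] X X] M by (intro exI[of _ M]) force
  qed
  then have "X \<longlonglongrightarrow> coding u t"
    unfolding coding_def X_def[symmetric] by (simp add: Cauchy_convergent_iff convergent_LIMSEQ_iff)
  moreover have "\<forall>\<^sub>F m' in sequentially. X m' \<in> Fw k (addr u m t) ` SG k"
    using X by (auto simp: eventually_sequentially)
  ultimately show ?thesis
    by (intro Lim_in_closed_set[OF closed_cell _ sequentially_bot]) auto
qed

definition ivl_measure :: "(nat \<Rightarrow> real) \<Rightarrow> real measure" where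
  "ivl_measure u = restrict_space lborel (ivl u [])"

lemma space_ivl_measure [simp]: "space (ivl_measure u) = ivl u []"
  by (simp add: ivl_measure_def space_restrict_space)

lemma ivl_subset: "w \<in> words k m \<Longrightarrow> ivl u w \<subseteq> ivl u []"
proof (induction m arbitrary: w)
  case (Suc m)
  then show ?case using ivl_snoc_subset unfolding words_Suc_snoc by (auto, blast)
qed auto

lemma ivl_sets: "w \<in> words k m \<Longrightarrow> ivl u w \<in> sets (ivl_measure u)"
  using ivl_subset[of w m u] unfolding ivl_measure_def
  by (subst sets_restrict_space_iff) (auto simp: ivl_def)

lemma emeasure_ivl: "w \<in> words k m \<Longrightarrow> emeasure (ivl_measure u) (ivl u w) = ennreal (mass u w)"
proof -
  assume "w \<in> words k m"
  then have "emeasure (ivl_measure u) (ivl u w) = emeasure lborel (ivl u w)"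
    unfolding ivl_measure_def using ivl_subset by (intro emeasure_restrict_space) (auto simp: ivl_def)
  then show ?thesis by (simp add: ivl_def)
qed

lemma finite_measure_ivl_measure: "finite_measure (ivl_measure u)"
  using emeasure_ivl[of "[]" 0 u] by (intro finite_measureI) auto

lemma measure_ivl: "w \<in> words k m \<Longrightarrow> measure (ivl_measure u) (ivl u w) = mass u w"
  by (simp add: measure_def emeasure_ivl)

lemma addr_measurable: "addr u m \<in> measurable (ivl_measure u) (count_space (words k m))"
proof (subst measurable_count_space_eq2, safe)
  fix w assume w: "w \<in> words k m"
  have "addr u m -` {w} \<inter> space (ivl_measure u) = ivl u w"
    using ivl_subset[OF w, of u] by (auto simp: addr_eq_iff[OF _ w] addr_ivl)
  then show "addr u m -` {w} \<inter> space (ivl_measure u) \<in> sets (ivl_measure u)" using ivl_sets[OF w] by simp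
qed (auto simp: addr_words)

lemma coding_measurable: "coding u \<in> measurable (ivl_measure u) (restrict_space borel (SG k))"
proof (rule measurable_restrict_space2)
  show "coding u \<in> space (ivl_measure u) \<rightarrow> SG k"
  proof
    fix t assume "t \<in> space (ivl_measure u)"
    then have t: "t \<in> ivl u []" by simp
    show "coding u t \<in> SG k"
      using coding_in_cell[OF t, of 0] addr_words[OF t, of 0] by simp
  qed
  show "coding u \<in> borel_measurable (ivl_measure u)"
    unfolding coding_def
    by (intro borel_measurable_lim_metric measurable_compose[OF addr_measurable])
       (auto simp: measurable_count_space_eq1)
qed

lemma coding_vimage_sets: "closed A \<Longrightarrow> coding u -` A \<inter> ivl u [] \<in> sets (ivl_measure u)"
proof -
  assume "closed A"
  then have "A \<inter> SG k \<in> sets (restrict_space borel (SG k))"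
    using closed_SG by (auto simp: SG_sets_iff)
  from measurable_sets[OF coding_measurable this]
  have "coding u -` (A \<inter> SG k) \<inter> ivl u [] \<in> sets (ivl_measure u)" by simp
  moreover have "coding u -` (A \<inter> SG k) \<inter> ivl u [] = coding u -` A \<inter> ivl u []"
    using coding_measurable[of u] by (auto simp: measurable_def space_restrict_space)
  ultimately show ?thesis by simp
qed

text \<open>At most four level-m cells contain \<open>x\<close>, and each has mass at most
  \<open>theta ^ m * vec_energy u\<close>.\<close>

lemma coding_point_null: "measure (ivl_measure u) (coding u -` {x} \<inter> ivl u []) = 0"
proof -
  interpret finite_measure "ivl_measure u" by (rule finite_measure_ivl_measure)
  let ?S = "coding u -` {x} \<inter> ivl u []"
  have le: "measure (ivl_measure u) ?S \<le> 4 * vec_energy u * theta ^ m" for m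
  proof -
    let ?W = "{w\<in>words k m. x \<in> Fw k w ` SG k}"
    have "?S \<subseteq> (\<Union>w\<in>?W. ivl u w)"
      using addr_words addr_ivl coding_in_cell by fastforce
    then have "measure (ivl_measure u) ?S \<le> measure (ivl_measure u) (\<Union>w\<in>?W. ivl u w)"
      using ivl_sets by (intro finite_measure_mono sets.finite_UN) auto
    also have "\<dots> \<le> (\<Sum>w\<in>?W. measure (ivl_measure u) (ivl u w))"
      using ivl_sets by (intro finite_measure_subadditive_finite) auto
    also have "\<dots> \<le> (\<Sum>w\<in>?W. theta ^ m * vec_energy u)"
      by (intro sum_mono) (auto simp: measure_ivl mass_decay)
    also have "\<dots> = real (card ?W) * (theta ^ m * vec_energy u)" by simp
    also have "\<dots> \<le> 4 * (theta ^ m * vec_energy u)"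
      using card_words_containing[of m x] theta by (intro mult_right_mono) auto
    finally show ?thesis by (simp add: mult_ac)
  qed
  have "(\<lambda>m. 4 * vec_energy u * theta ^ m) \<longlonglongrightarrow> 4 * vec_energy u * 0"
    using theta by (intro tendsto_mult tendsto_const LIMSEQ_power_zero) auto
  then have "measure (ivl_measure u) ?S \<le> 4 * vec_energy u * 0"
    by (rule LIMSEQ_le_const) (use le in auto)
  then show ?thesis using measure_nonneg[of "ivl_measure u" ?S] by linarith
qed

text \<open>The preimage of a cell contains the interval of its word. Any further \<open>t\<close>
  has another address of the same level, so it is coded to one of the finitely many points shared
  with another cell, and these have null preimages.\<close>

lemma cell_measure_coding: "cell_measure u (distr (ivl_measure u) (restrict_space borel (SG k)) (coding u))"
  unfolding cell_measure_def
proof (intro conjI allI ballI)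
  fix m w assume w: "w \<in> words k m"
  interpret finite_measure "ivl_measure u" by (rule finite_measure_ivl_measure)
  let ?C = "\<lambda>w. Fw k w ` SG k"
  define P where "P = (\<Union>v\<in>words k m - {w}. ?C w \<inter> ?C v)"
  have "finite P"
    unfolding P_def by (intro finite_UN_I cells_meet_finite[OF w]) auto
  have S: "coding u -` ?C w \<inter> ivl u [] \<in> sets (ivl_measure u)"
    by (rule coding_vimage_sets[OF closed_cell])
  have "ivl u w \<subseteq> coding u -` ?C w \<inter> ivl u []"
    using coding_in_cell[of _ u m] addr_eqI[OF _ w] ivl_subset[OF w] by fastforce
  then have lower: "mass u w \<le> measure (ivl_measure u) (coding u -` ?C w \<inter> ivl u [])"
    using finite_measure_mono[OF _ S] measure_ivl[OF w] by metis
  have pt: "coding u -` {x} \<inter> ivl u [] \<in> sets (ivl_measure u)" for x by (rule coding_vimage_sets) simp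
  have sub: "coding u -` ?C w \<inter> ivl u [] \<subseteq> ivl u w \<union> (\<Union>x\<in>P. coding u -` {x} \<inter> ivl u [])"
  proof
    fix t assume t: "t \<in> coding u -` ?C w \<inter> ivl u []"
    show "t \<in> ivl u w \<union> (\<Union>x\<in>P. coding u -` {x} \<inter> ivl u [])"
    proof (cases "addr u m t = w")
      case True
      then show ?thesis using addr_ivl[of t u m] t by auto
    next
      case False
      then have "coding u t \<in> P"
        using coding_in_cell[of t u m] addr_words[of t u m] t unfolding P_def by blast
      then show ?thesis using t by auto
    qed
  qed
  have "measure (ivl_measure u) (coding u -` ?C w \<inter> ivl u [])
      \<le> measure (ivl_measure u) (ivl u w \<union> (\<Union>x\<in>P. coding u -` {x} \<inter> ivl u []))"
    using sub pt ivl_sets[OF w] \<open>finite P\<close> by (intro finite_measure_mono sets.Un sets.finite_UN) auto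
  also have "\<dots> \<le> measure (ivl_measure u) (ivl u w) + measure (ivl_measure u) (\<Union>x\<in>P. coding u -` {x} \<inter> ivl u [])"
    using pt ivl_sets[OF w] \<open>finite P\<close> by (intro measure_Un_le sets.finite_UN) auto
  also have "measure (ivl_measure u) (\<Union>x\<in>P. coding u -` {x} \<inter> ivl u [])
      \<le> (\<Sum>x\<in>P. measure (ivl_measure u) (coding u -` {x} \<inter> ivl u []))"
    using pt \<open>finite P\<close> by (intro finite_measure_subadditive_finite) auto
  also have "\<dots> = 0" by (simp add: coding_point_null)
  finally have "measure (ivl_measure u) (coding u -` ?C w \<inter> ivl u []) = mass u w"
    using lower measure_ivl[OF w] by simp
  then show "emeasure (distr (ivl_measure u) (restrict_space borel (SG k)) (coding u)) (?C w) = ennreal (mass u w)"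
    using emeasure_distr[OF coding_measurable cell_sets[OF w], of u] by (simp add: emeasure_eq_measure)
qed simp

section \<open>The energy measures and their self-similarity\<close>

lemma cell_measure_nu:
  assumes "j < 3" shows "cell_measure (unit_vec j) (nu k j)"
proof -
  have P: "(sets \<nu> = sets (restrict_space borel (SG k)) \<and>
     (\<forall>m. \<forall>w\<in>words k m. emeasure \<nu> (Fw k w ` SG k) =
          ennreal (rk k powi (- int m) * energy k (hb k j \<circ> Fw k w)))) \<longleftrightarrow> cell_measure (unit_vec j) \<nu>" for \<nu>
    unfolding cell_measure_def using assms by (simp add: energy_hb_cell)
  have "\<exists>!\<nu>. cell_measure (unit_vec j) \<nu>"
    using cell_measure_coding cell_measure_unique by blast
  from theI'[OF this] show ?thesis
    unfolding nu_def energy_measure_def P .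
qed

lemma measure_nu_cell:
  assumes "n < d" "w \<in> words k m" "j < 3"
  shows "measure (nu k j) (F k n ` Fw k w ` SG k) = (\<Sum>i<3. mu k n j i * measure (nu k i) (Fw k w ` SG k))"
proof -
  have "F k n ` Fw k w ` SG k = Fw k (n # w) ` SG k" by (simp add: image_comp)
  moreover have "n # w \<in> words k (Suc m)" using assms by (simp add: Cons_in_words)
  ultimately have "measure (nu k j) (F k n ` Fw k w ` SG k) = mass (unit_vec j) (n # w)"
    using cell_measure_cell[OF cell_measure_nu] assms(3) by metis
  then show ?thesis
    using assms by (simp add: cell_measure_cell[OF cell_measure_nu] mass_Cons)
qed

text \<open>The cell of \<open>n # w\<close> meets \<open>A\<close> exactly when the cell of
  \<open>w\<close> meets the preimage of \<open>A\<close> under \<open>F k n\<close>.\<close>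

lemma hit_Suc:
  assumes "A \<subseteq> SG k"
  shows "(\<Sum>w\<in>hit (Suc m) A. g w) = (\<Sum>n<d. \<Sum>w\<in>hit m (F k n -` A \<inter> SG k). g (n # w))"
proof -
  have "hit (Suc m) A = (\<lambda>(n, w). n # w) ` (SIGMA n:{..<d}. hit m (F k n -` A \<inter> SG k))"
    unfolding hit_def words_Suc_Cons using Fw_in_SG by (fastforce simp: image_iff)
  then show ?thesis
    by (simp add: sum.reindex inj_on_def split_beta)
       (subst sum.Sigma, auto simp: hit_def split_beta)
qed

lemma measure_nu_self_similar:
  assumes A: "A \<in> sets (restrict_space borel (SG k))" and j: "j < 3"
  shows "measure (nu k j) A = (\<Sum>n<d. \<Sum>i<3. mu k n j i * measure (nu k i) (F k n -` A \<inter> SG k))"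
proof -
  have A': "A \<subseteq> SG k" "A \<in> sets borel" using A by (auto simp: SG_sets_iff)
  have F: "continuous_on UNIV (F k n)" for n by (rule continuous_on_F)
  have "measure (nu k j) (A \<inter> SG k)
      = (\<Sum>n<d. \<Sum>i<3. mu k n j i * measure (nu k i) (F k n -` A \<inter> SG k))"
  proof (rule borel_additive_eqI[where g = "\<lambda>A. \<Sum>n<d. \<Sum>i<3. mu k n j i * measure (nu k i) (F k n -` A \<inter> SG k)"])
    show "borel_additive (\<lambda>A. measure (nu k j) (A \<inter> SG k))"
      by (rule borel_additive_cell_measure_id[OF cell_measure_nu[OF j]])
    show "borel_additive (\<lambda>A. \<Sum>n<d. \<Sum>i<3. mu k n j i * measure (nu k i) (F k n -` A \<inter> SG k))"
      by (intro borel_additive_sum borel_additive_cmult borel_additive_cell_measure[OF cell_measure_nu F]) auto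
    fix C :: "complex set" assume C: "closed C"
    define B where "B = C \<inter> SG k"
    have B: "closed B" "B \<subseteq> SG k" using C closed_SG by (auto simp: B_def)
    have FB: "F k n -` C \<inter> SG k = F k n -` B \<inter> SG k" if "n < d" for n
      using that F_in_SG by (auto simp: B_def)
    have FC: "closed (F k n -` B \<inter> SG k)" for n
      using B(1) F closed_SG by (intro closed_Int closed_vimage) (auto simp: continuous_on_eq_continuous_at)
    \<comment> \<open>The level is shifted by one so that a first letter can be split off: the
      remaining words of length \<open>m\<close> then approximate the preimages at the same rate for
      every \<open>n\<close>.\<close>
    have "(\<lambda>m. \<Sum>w\<in>hit (Suc m) B. mass (unit_vec j) w) \<longlonglongrightarrow> measure (nu k j) B"
      by (rule LIMSEQ_Suc[OF cell_measure_closed_LIMSEQ[OF cell_measure_nu[OF j] B]])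
    moreover have "(\<Sum>w\<in>hit (Suc m) B. mass (unit_vec j) w)
        = (\<Sum>n<d. \<Sum>i<3. mu k n j i * (\<Sum>w\<in>hit m (F k n -` B \<inter> SG k). mass (unit_vec i) w))" for m
    proof -
      have "(\<Sum>w\<in>hit m (F k n -` B \<inter> SG k). mass (unit_vec j) (n # w))
          = (\<Sum>w\<in>hit m (F k n -` B \<inter> SG k). \<Sum>i<3. mu k n j i * mass (unit_vec i) w)" if "n < d" for n
        using that j by (intro sum.cong) (auto simp: hit_def mass_Cons)
      then show ?thesis
        unfolding hit_Suc[OF B(2)] sum_distrib_left
        by (intro sum.cong) (auto intro: trans[OF _ sum.swap])
    qed
    moreover have "(\<lambda>m. \<Sum>n<d. \<Sum>i<3. mu k n j i * (\<Sum>w\<in>hit m (F k n -` B \<inter> SG k). mass (unit_vec i) w))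
        \<longlonglongrightarrow> (\<Sum>n<d. \<Sum>i<3. mu k n j i * measure (nu k i) (F k n -` B \<inter> SG k))"
      by (intro tendsto_intros cell_measure_closed_LIMSEQ[OF cell_measure_nu FC]) auto
    ultimately have "measure (nu k j) B = (\<Sum>n<d. \<Sum>i<3. mu k n j i * measure (nu k i) (F k n -` B \<inter> SG k))"
      using LIMSEQ_unique by auto
    then show "measure (nu k j) (C \<inter> SG k)
        = (\<Sum>n<d. \<Sum>i<3. mu k n j i * measure (nu k i) (F k n -` C \<inter> SG k))"
      using FB by (simp add: B_def)
  qed (rule A'(2))
  then show ?thesis using A'(1) by (simp add: Int_absorb2)
qed

end

theorem theorem2p9:
  fixes k :: nat
  assumes "k \<ge> 2"
  shows "(\<forall>n<sg_d k. \<forall>m. \<forall>w\<in>words k m. \<forall>j<3.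
            measure (nu k j) (F k n ` Fw k w ` SG k)
              = (\<Sum>i<3. mu k n j i * measure (nu k i) (Fw k w ` SG k)))
       \<and> (\<forall>A\<in>sets (restrict_space borel (SG k)). \<forall>j<3.
            measure (nu k j) A
              = (\<Sum>n<sg_d k. \<Sum>i<3. mu k n j i * measure (nu k i) (F k n -` A \<inter> SG k)))"
proof -
  interpret sierpinski k by unfold_locales (rule assms)
  show ?thesis using measure_nu_cell measure_nu_self_similar by blast
qed

end
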